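(* For all $\varepsilon,\gamma>0$: (i) for the fraction $L_{E,n}$, $$\inf_{\varepsilon>0}C_{AB}^{E}(g_0,\varepsilon,\gamma)\ge\frac{1}{3\sqrt{2\pi}}\sup_{\frac12<p<1}\frac{p+1}{\max\{1-p,\ \gamma(1-p)^2+p^2,\ \gamma(2p-1)\}},$$ in particular $\inf_{\varepsilon>0}C_{AB}^{E}(g_0,\varepsilon,1)\ge\frac{\sqrt{10}+3}{6\sqrt{2\pi}}=0.4097\ldots$; (ii) for the fraction $L_{R,n}$, $$C_{AB}^{R}(g_0,\varepsilon,\gamma)\ge\begin{cases}\dfrac{1+\sqrt5}{3\sqrt{2\pi}\big(2\gamma\min\{\varepsilon^{-1},1\}(\sqrt5-2)+3-\sqrt5\big)},&\dfrac{\gamma}{\max\{\varepsilon,1\}}<\dfrac23,\\[3mm] \dfrac1{\sqrt{2\pi}}=0.3989\ldots,&\dfrac{\gamma}{\max\{\varepsilon,1\}}\ge\dfrac23;\end{cases}$$ (iii) $C_{AB}^{E}(g_1,\varepsilon,\gamma)=C_{AB}^{R}(g_1,\varepsilon,\gamma)=0$.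
   Context: $\Phi$ is the standard normal distribution function. Let $\mathcal F$ be the set of non-degenerate distribution functions with zero mean and finite second moment. For $F\in\mathcal F$ let $X_1,\dots,X_n$ be i.i.d. with distribution function $F$, $\sigma_1^2={\sf E}X_1^2$, $B_n^2=n\sigma_1^2$, $S_n=X_1+\dots+X_n$, $\Delta_n(F)=\sup_x|{\sf P}(S_n/B_n<x)-\Phi(x)|$, $\mu_1(z)={\sf E}X_1^3\mathbf 1(|X_1|<z)$, $\sigma_1^2(z)={\sf E}X_1^2\mathbf 1(|X_1|\ge z)$, $M_n(z)=nB_n^{-3}\mu_1(zB_n)$, $L_n(z)=nB_n^{-2}\sigma_1^2(zB_n)$. Let $\mathcal G$ be the set of non-decreasing $g:[0,\infty)\to[0,\infty)$ with $g(z)>0$ for $z>0$ and $z/g(z)$ non-decreasing on $(0,\infty)$. For $g\in\mathcal G$, $\varepsilon,\gamma>0$: $L_{E,n}(g,\varepsilon,\gamma)=\sup_{0<z<\varepsilon}\frac{g(zB_n)}{zg(B_n)}(\gamma|M_n(z)|+zL_n(z))$ and $L_{R,n}(g,\varepsilon,\gamma)=\gamma\frac{g(\varepsilon B_n)}{\varepsilon g(B_n)}|M_n(\varepsilon)|+\sup_{0<z<\varepsilon}\frac{g(zB_n)}{g(B_n)}L_n(z)$. Here $g_0(z)=\min\{z,B_n\}$ and $g_1(z)=\max\{z,B_n\}$. The asymptotically best constants are $C_{AB}^{E}(g,\varepsilon,\gamma)=\sup_{F\in\mathcal F}\limsup_{n\to\infty}\Delta_n(F)/L_{E,n}(g,\varepsilon,\gamma)$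 and $C_{AB}^{R}(g,\varepsilon,\gamma)=\sup_{F\in\mathcal F}\limsup_{n\to\infty}\Delta_n(F)/L_{R,n}(g,\varepsilon,\gamma)$ (the fractions computed for the distribution $F$). *)

theory Defs
  imports "HOL-Probability.Probability"
begin

definition Phi :: "real \<Rightarrow> real" where
  "Phi x = measure (density lborel std_normal_density) {..<x}"

definition distF :: "real measure set" where
  "distF = {F. prob_space F \<and> sets F = sets borel \<and>
               integrable F (\<lambda>x. x\<^sup>2) \<and> integrable F (\<lambda>x. x) \<and>
               (\<integral>x. x \<partial>F) = 0 \<and> \<not> (\<exists>c. F = return borel c)}"

definition sigma1sq :: "real measure \<Rightarrow> real" where
  "sigma1sq F = (\<integral>x. x\<^sup>2 \<partial>F)"

definition Bn :: "real measure \<Rightarrow> nat \<Rightarrow> real" where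
  "Bn F n = sqrt (real n * sigma1sq F)"

definition iidM :: "real measure \<Rightarrow> nat \<Rightarrow> (nat \<Rightarrow> real) measure" where
  "iidM F n = PiM {..<n} (\<lambda>_. F)"

definition Delta :: "real measure \<Rightarrow> nat \<Rightarrow> real" where
  "Delta F n = (SUP x. \<bar>measure (iidM F n)
       {\<omega> \<in> space (iidM F n). (\<Sum>i<n. \<omega> i) / Bn F n < x} - Phi x\<bar>)"

definition mu1 :: "real measure \<Rightarrow> real \<Rightarrow> real" where
  "mu1 F z = (\<integral>x. x ^ 3 * indicator {x. \<bar>x\<bar> < z} x \<partial>F)"

definition sigma1sq_tail :: "real measure \<Rightarrow> real \<Rightarrow> real" where
  "sigma1sq_tail F z = (\<integral>x. x\<^sup>2 * indicator {x. \<bar>x\<bar> \<ge> z} x \<partial>F)"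

definition Mn :: "real measure \<Rightarrow> nat \<Rightarrow> real \<Rightarrow> real" where
  "Mn F n z = real n * Bn F n powr (-3) * mu1 F (z * Bn F n)"

definition Ln :: "real measure \<Rightarrow> nat \<Rightarrow> real \<Rightarrow> real" where
  "Ln F n z = real n * Bn F n powr (-2) * sigma1sq_tail F (z * Bn F n)"

text \<open>The functions g may depend on n (through B_n): g F n is the function used at step n.\<close>
definition L_E :: "real measure \<Rightarrow> (nat \<Rightarrow> real \<Rightarrow> real) \<Rightarrow> real \<Rightarrow> real \<Rightarrow> nat \<Rightarrow> real" where
  "L_E F g \<epsilon> \<gamma> n = (SUP z \<in> {0<..<\<epsilon>}.
      g n (z * Bn F n) / (z * g n (Bn F n)) * (\<gamma> * \<bar>Mn F n z\<bar> + z * Ln F n z))"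

definition L_R :: "real measure \<Rightarrow> (nat \<Rightarrow> real \<Rightarrow> real) \<Rightarrow> real \<Rightarrow> real \<Rightarrow> nat \<Rightarrow> real" where
  "L_R F g \<epsilon> \<gamma> n = \<gamma> * g n (\<epsilon> * Bn F n) / (\<epsilon> * g n (Bn F n)) * \<bar>Mn F n \<epsilon>\<bar>
      + (SUP z \<in> {0<..<\<epsilon>}. g n (z * Bn F n) / g n (Bn F n) * Ln F n z)"

definition g0 :: "real measure \<Rightarrow> nat \<Rightarrow> real \<Rightarrow> real" where
  "g0 F n z = min z (Bn F n)"

definition g1 :: "real measure \<Rightarrow> nat \<Rightarrow> real \<Rightarrow> real" where
  "g1 F n z = max z (Bn F n)"

text \<open>Asymptotically best constants; the choice of g may depend on F (via B_n).\<close>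
definition C_AB_E :: "(real measure \<Rightarrow> nat \<Rightarrow> real \<Rightarrow> real) \<Rightarrow> real \<Rightarrow> real \<Rightarrow> ereal" where
  "C_AB_E g \<epsilon> \<gamma> = (SUP F \<in> distF. limsup (\<lambda>n. ereal (Delta F n / L_E F (g F) \<epsilon> \<gamma> n)))"

definition C_AB_R :: "(real measure \<Rightarrow> nat \<Rightarrow> real \<Rightarrow> real) \<Rightarrow> real \<Rightarrow> real \<Rightarrow> ereal" where
  "C_AB_R g \<epsilon> \<gamma> = (SUP F \<in> distF. limsup (\<lambda>n. ereal (Delta F n / L_R F (g F) \<epsilon> \<gamma> n)))"

end

theory Submission
  imports Defs "HOL-Real_Asymp.Real_Asymp"
begin

text \<open>
  The lower bounds come from centred Bernoulli variables with parameter \<open>p\<close>. For these both fractions,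
  multiplied by \<open>B\<^sub>n\<close>, are bounded by explicit constants, so one needs the sharp constant in
  \<open>B\<^sub>n \<Delta>\<^sub>n\<close>, which is \<open>(p + 1) / (3 sqrt (2 \<pi>))\<close> by Esseen's expansion for lattice
  distributions. Here it is obtained directly: the binomial tail is an incomplete beta integral, and
  when the number of trials is \<open>n + 1\<close> with \<open>k = p n\<close> an integer, the integrand
  \<open>x^k (1 - x)^(n - k)\<close> has its maximum exactly at \<open>p\<close>. After rescaling by \<open>sqrt n\<close>, dominated convergence
  gives both the mass of the integrand and the first-order term of its asymmetry about \<open>p\<close>. This
  covers rational \<open>p\<close>; the resulting bounds are continuous in \<open>p\<close>.

  For \<open>g1\<close> both fractions stay above \<open>1/2\<close>, because \<open>L\<^sub>n(z)\<close> tends to 1 as \<open>z\<close> tends to 0,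
  while \<open>\<Delta>\<^sub>n\<close> tends to 0 by the central limit theorem and Polya's theorem.
\<close>

subsection \<open>The standard normal distribution function\<close>

text \<open>Esseen's constant comes from one lattice point, since only a lower bound for the
  discrepancy is needed. Placing the mode of the integrand at \<open>p\<close> removes the linear
  term of its exponent: both halves about \<open>p\<close> then have the same Gaussian limit, and
  their difference, of relative order 1/sqrt n, is governed by the cubic Taylor coefficient alone.
  What is needed of the binomial tail is (left mass - right mass) / total mass, so the normalising
  constant cancels and no Stirling formula enters. Two effects of the same order add up after
  multiplication by B_n: the distance 1-p from the mean to the next lattice point contributes (1-p)
  / sqrt(2 pi), and the skewness contributes 2(2p-1) / (3 sqrt(2 pi)). Their sum is (p+1) / (3
  sqrt(2 pi)). The explicit constants of the theorem arise from maximising the ratio of this number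
  to the bound for the fraction over p.\<close>

lemma measure_std_normal:
  assumes "A \<in> sets borel"
  shows "measure (density lborel std_normal_density) A = (\<integral>x. std_normal_density x * indicator A x \<partial>lborel)"
    and "integrable lborel (\<lambda>x. std_normal_density x * indicator A x)"
proof -
  show i: "integrable lborel (\<lambda>x. std_normal_density x * indicator A x)"
    using integrable_mult_indicator[OF _ integrable_normal_density[of 1 0], of A] assms
    by (simp add: mult.commute)
  have "emeasure (density lborel std_normal_density) A = (\<integral>\<^sup>+x. ennreal (std_normal_density x * indicator A x) \<partial>lborel)"
    using assms by (subst emeasure_density) (auto intro!: nn_integral_cong simp: indicator_def)
  also have "\<dots> = ennreal (\<integral>x. std_normal_density x * indicator A x \<partial>lborel)"
    by (rule nn_integral_eq_integral[OF i]) (simp add: AE_I2)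
  finally show "measure (density lborel std_normal_density) A = (\<integral>x. std_normal_density x * indicator A x \<partial>lborel)"
    by (simp add: measure_def)
qed

interpretation std_normal: real_distribution "density lborel std_normal_density"
  by (rule real_dist_normal_dist)

lemma measure_std_normal_singleton: "measure (density lborel std_normal_density) {x} = 0"
proof -
  have "emeasure (density lborel std_normal_density) {x} = 0"
    by (simp add: emeasure_density_const emeasure_density AE_lborel_singleton nn_integral_0_iff_AE)
  thus ?thesis by (simp add: measure_def)
qed

text \<open>\<open>Phi\<close> is defined by a strict inequality and \<open>cdf\<close> by a weak
  one; the normal law has no atoms, so the facts about \<open>cdf\<close> carry over.\<close>

lemma Phi_eq_cdf: "Phi x = cdf (density lborel std_normal_density) x"
proof -
  have "measure (density lborel std_normal_density) {..x} =
      measure (density lborel std_normal_density) {..<x} + measure (density lborel std_normal_density) {x}"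
    by (subst std_normal.finite_measure_Union[symmetric]) (auto intro!: arg_cong[where f="measure _"])
  thus ?thesis by (simp add: Phi_def cdf_def2 measure_std_normal_singleton)
qed

lemma isCont_Phi: "isCont Phi x"
  unfolding Phi_eq_cdf[abs_def] by (simp add: std_normal.isCont_cdf measure_std_normal_singleton)

lemma Phi_mono: "x \<le> y \<Longrightarrow> Phi x \<le> Phi y"
  unfolding Phi_eq_cdf by (rule std_normal.cdf_nondecreasing)

lemma Phi_0: "Phi 0 = 1 / 2"
proof -
  have "Phi 0 = (\<integral>x. std_normal_density x * indicator {..<0} x \<partial>lborel)"
    by (simp add: Phi_def measure_std_normal)
  also have "\<dots> = (\<integral>x. std_normal_density (0 + -1 * x) * indicator {..<0} (0 + -1 * x) \<partial>lborel)"
    using lborel_integral_real_affine[of "-1" "\<lambda>x. std_normal_density x * indicator {..<0} x" 0] by simp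
  also have "(\<lambda>x. std_normal_density (0 + -1 * x) * indicator {..<0} (0 + -1 * x))
      = (\<lambda>x::real. std_normal_density x * indicator {0<..} x)"
    by (auto simp: std_normal_density_def indicator_def)
  also have "(\<integral>x. std_normal_density x * indicator {0<..} x \<partial>lborel) = measure (density lborel std_normal_density) {0<..}"
    by (simp add: measure_std_normal)
  also have "\<dots> = 1 - Phi 0"
    using std_normal.prob_compl[of "{..0}"] unfolding Phi_eq_cdf cdf_def2
    by (simp add: Compl_eq_Diff_UNIV[symmetric])
  finally show ?thesis by simp
qed

text \<open>The density decreases on the positive half-line, so the area over \<open>{0..<x}\<close>
  is at least that of the rectangle with the height at its right end. This is sharp to first order
  as \<open>x\<close> tends to 0, which is all the asymptotics need.\<close>

lemma Phi_ge:
  assumes x: "x \<ge> 0"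
  shows "Phi x \<ge> 1 / 2 + x * std_normal_density x"
proof -
  have "x * std_normal_density x = (\<integral>t. std_normal_density x * indicator {0..<x} t \<partial>lborel)"
    using x by simp
  also have "\<dots> \<le> (\<integral>t. std_normal_density t * indicator {0..<x} t \<partial>lborel)"
  proof (rule integral_mono)
    show "integrable lborel (\<lambda>t. std_normal_density x * indicator {0..<x} t)"
      using x by (intro integrable_mult_right integrable_real_indicator) auto
    show "std_normal_density x * indicator {0..<x} t \<le> std_normal_density t * indicator {0..<x} t" for t
      by (auto simp: std_normal_density_def indicator_def divide_right_mono power_mono)
  qed (simp add: measure_std_normal)
  also have "\<dots> = measure (density lborel std_normal_density) {0..<x}"
    by (simp add: measure_std_normal)
  also have "\<dots> = Phi x - Phi 0"
  proof -
    have eq: "{..<0} \<union> {0..<x} = {..<x}" using x by auto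
    have "measure (density lborel std_normal_density) {..<x}
        = measure (density lborel std_normal_density) {..<0} + measure (density lborel std_normal_density) {0..<x}"
      using std_normal.finite_measure_Union[of "{..<0}" "{0..<x}", unfolded eq] by fastforce
    thus ?thesis by (simp add: Phi_def)
  qed
  finally show ?thesis by (simp add: Phi_0)
qed

subsection \<open>The Laplace exponent of the binomial tail\<close>

text \<open>Minus the relative entropy of Bernoulli(\<open>p\<close>) with respect to
  Bernoulli(\<open>p + u\<close>). It is the exponent per trial of the beta integrand at
  \<open>p + u\<close>, relative to its value at the mode \<open>p\<close>.\<close>

definition psi :: "real \<Rightarrow> real \<Rightarrow> real" where
  "psi p u = p * ln (1 + u / p) + (1 - p) * ln (1 - u / (1 - p))"

text \<open>The derivative of \<open>psi p u + u^2 / 2\<close> is \<open>u\<close> times a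
  nonpositive factor, because \<open>(p + u) * (1 - p - u) \<le> 1\<close>; hence the maximum is at
  0. The constant is not sharp, but it yields a Gaussian majorant free of both \<open>n\<close> and
  \<open>p\<close>.\<close>

lemma psi_le_neg_square:
  assumes p: "0 < p" "p < 1" and u: "-p < u" "u < 1 - p"
  shows "psi p u \<le> - u\<^sup>2 / 2"
proof -
  define f where "f u = psi p u + u\<^sup>2 / 2" for u
  have der: "(f has_real_derivative x * (1 - 1 / ((p + x) * (1 - p - x)))) (at x)"
    if "-p < x" "x < 1 - p" for x
  proof -
    have pos: "1 + x / p > 0" "1 - x / (1 - p) > 0" using p that by (auto simp: field_simps)
    have "((\<lambda>u. ln (1 + u / p)) has_real_derivative 1 / (p + x)) (at x)"
      using p that pos by (auto intro!: derivative_eq_intros simp: field_simps)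
    moreover have "((\<lambda>u. ln (1 - u / (1 - p))) has_real_derivative - 1 / (1 - p - x)) (at x)"
      using p that pos by (auto intro!: derivative_eq_intros simp: divide_simps)
    moreover have "((\<lambda>u. u\<^sup>2 / 2) has_real_derivative x) (at x)"
      by (auto intro!: derivative_eq_intros)
    ultimately have "(f has_real_derivative p * (1 / (p + x)) + (1 - p) * (- 1 / (1 - p - x)) + x) (at x)"
      unfolding f_def psi_def by (intro DERIV_add DERIV_cmult)
    also have "p * (1 / (p + x)) + (1 - p) * (- 1 / (1 - p - x)) + x = x * (1 - 1 / ((p + x) * (1 - p - x)))"
      using that by (simp add: divide_simps) (simp add: algebra_simps)
    finally show ?thesis .
  qed
  have neg: "1 - 1 / ((p + x) * (1 - p - x)) \<le> 0" if "-p < x" "x < 1 - p" for x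
  proof -
    have "(p + x) * (1 - p - x) \<le> 1 * 1" using that by (intro mult_mono) auto
    thus ?thesis using that by (auto simp: divide_simps)
  qed
  have "f u \<le> f 0"
  proof (cases "u \<ge> 0")
    case True
    show ?thesis
    proof (rule DERIV_nonpos_imp_nonincreasing[of 0 u f, OF True])
      show "\<exists>y. DERIV f x :> y \<and> y \<le> 0" if "0 \<le> x" "x \<le> u" for x
        using der[of x] neg[of x] u p that by (fastforce intro!: mult_nonneg_nonpos)
    qed
  next
    case False
    show ?thesis
    proof (rule DERIV_nonneg_imp_nondecreasing[of u 0 f])
      show "u \<le> 0" using False by simp
      show "\<exists>y. DERIV f x :> y \<and> y \<ge> 0" if "u \<le> x" "x \<le> 0" for x
        using der[of x] neg[of x] u p that by (fastforce intro!: mult_nonpos_nonpos)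
    qed
  qed
  also have "f 0 = 0" by (simp add: f_def psi_def)
  finally show ?thesis by (simp add: f_def)
qed

lemma psi_quadratic:
  assumes p: "0 < p" "p < 1"
  shows "((\<lambda>u. psi p u / u\<^sup>2) \<longlongrightarrow> - 1 / (2 * (p * (1 - p)))) (at 0)"
proof -
  \<comment> \<open>With \<open>a = 1/p\<close> and \<open>b = 1/(1-p)\<close> treated as
    independent parameters, the expansion needs only their signs.\<close>
  have "((\<lambda>u. (ln (1 + a*u) / a + ln (1 - b*u) / b) / u^2) \<longlongrightarrow> -(a + b) / 2) (at 0)"
    if "a > 0" "b > 0" for a b :: real using that by (real_asymp simp: field_simps)
  from this[of "1/p" "1/(1-p)"]
  have "((\<lambda>u. psi p u / u\<^sup>2) \<longlongrightarrow> - (1/p + 1/(1-p)) / 2) (at 0)"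
    using p by (simp add: psi_def mult.commute)
  also have "- (1/p + 1/(1-p)) / 2 = - 1 / (2 * (p * (1 - p)))"
    using p by (simp add: divide_simps)
  finally show ?thesis .
qed

text \<open>Even Taylor terms cancel in the difference, so the cubic ones lead. For
  \<open>p > 1/2\<close> the limit is positive: the integrand is heavier to the left of its
  mode.\<close>

lemma psi_skew:
  assumes p: "0 < p" "p < 1"
  shows "((\<lambda>u. (psi p (-u) - psi p u) / u^3) \<longlongrightarrow> 2 / 3 * (2*p - 1) / (p * (1 - p))\<^sup>2) (at_right 0)"
proof -
  have "((\<lambda>u. (ln (1 - a*u) / a + ln (1 + b*u) / b - (ln (1 + a*u) / a + ln (1 - b*u) / b)) / u^3)
     \<longlongrightarrow> 2/3 * (b\<^sup>2 - a\<^sup>2)) (at_right 0)"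
    if "a > 0" "b > 0" for a b :: real using that by (real_asymp simp: field_simps power2_eq_square)
  from this[of "1/p" "1/(1-p)"]
  have "((\<lambda>u. (psi p (-u) - psi p u) / u^3) \<longlongrightarrow> 2/3 * ((1/(1-p))\<^sup>2 - (1/p)\<^sup>2)) (at_right 0)"
    using p by (simp add: psi_def mult.commute)
  also have "2/3 * ((1/(1-p))\<^sup>2 - (1/p)\<^sup>2) = 2 / 3 * (2*p - 1) / (p * (1 - p))\<^sup>2"
    using p by (simp add: divide_simps) (simp add: algebra_simps power2_eq_square)
  finally show ?thesis .
qed

text \<open>The beta integrand in the variable \<open>s = sqrt n * (x - p)\<close>, divided by its
  value at the mode. The cut-off is the image of \<open>0 < x < 1\<close>, outside of which the
  logarithms in \<open>psi\<close> have no meaning here.\<close>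

definition bump :: "real \<Rightarrow> nat \<Rightarrow> real \<Rightarrow> real" where
  "bump p n s = (if - p < s / sqrt n \<and> s / sqrt n < 1 - p then exp (n * psi p (s / sqrt n)) else 0)"

lemma borel_measurable_bump [measurable]: "bump p n \<in> borel_measurable borel"
  unfolding bump_def psi_def by measurable

lemma bump_nonneg: "0 \<le> bump p n s"
  by (simp add: bump_def)

lemma bump_le:
  assumes p: "0 < p" "p < 1" and n: "n > 0"
  shows "bump p n s \<le> exp (- s\<^sup>2 / 2)"
proof (cases "- p < s / sqrt n \<and> s / sqrt n < 1 - p")
  case True
  have "n * psi p (s / sqrt n) \<le> n * (- (s / sqrt n)\<^sup>2 / 2)"
    by (intro mult_left_mono psi_le_neg_square) (use p True in auto)
  also have "\<dots> = - s\<^sup>2 / 2" using n by (simp add: power_divide)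
  finally show ?thesis using True by (simp add: bump_def)
qed (auto simp: bump_def)

lemma filterlim_div_sqrt_at_0:
  assumes "s \<noteq> 0"
  shows "filterlim (\<lambda>n. s / sqrt (real n)) (at 0) sequentially"
    and "s > 0 \<Longrightarrow> filterlim (\<lambda>n. s / sqrt (real n)) (at_right 0) sequentially"
proof -
  have lim: "(\<lambda>n. s / sqrt (real n)) \<longlonglongrightarrow> 0" by real_asymp
  show "filterlim (\<lambda>n. s / sqrt (real n)) (at 0) sequentially"
    using assms lim by (auto simp: filterlim_at intro!: eventually_mono[OF eventually_gt_at_top[of 0]])
  show "filterlim (\<lambda>n. s / sqrt (real n)) (at_right 0) sequentially" if "s > 0"
    using that lim by (auto simp: filterlim_at intro!: eventually_mono[OF eventually_gt_at_top[of 0]])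
qed

lemma eventually_div_sqrt_small:
  fixes s \<delta> :: real assumes "\<delta> > 0"
  shows "eventually (\<lambda>n. \<bar>s / sqrt (real n)\<bar> < \<delta>) sequentially"
proof -
  have "(\<lambda>n. s / sqrt (real n)) \<longlonglongrightarrow> 0" by real_asymp
  from tendstoD[OF this assms] show ?thesis by (simp add: dist_real_def)
qed

lemma tendsto_psi_scaled:
  assumes p: "0 < p" "p < 1"
  shows "(\<lambda>n. real n * psi p (s / sqrt n)) \<longlonglongrightarrow> - s\<^sup>2 / (2 * (p * (1 - p)))"
proof (cases "s = 0")
  case False
  have "(\<lambda>n. s\<^sup>2 * (psi p (s / sqrt n) / (s / sqrt n)\<^sup>2)) \<longlonglongrightarrow> s\<^sup>2 * (- 1 / (2 * (p * (1 - p))))"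
    by (intro tendsto_intros filterlim_compose[OF psi_quadratic[OF p]] filterlim_div_sqrt_at_0 False)
  moreover have "eventually (\<lambda>n. s\<^sup>2 * (psi p (s / sqrt n) / (s / sqrt n)\<^sup>2) = n * psi p (s / sqrt n)) sequentially"
    using eventually_gt_at_top[of 0] by eventually_elim (use False in \<open>simp add: power_divide\<close>)
  ultimately show ?thesis by (auto dest: Lim_transform_eventually)
qed (simp add: psi_def)

lemma eventually_bump_eq:
  assumes p: "0 < p" "p < 1"
  shows "eventually (\<lambda>n. bump p n s = exp (real n * psi p (s / sqrt n))) sequentially"
proof -
  have "min p (1 - p) > 0" using p by simp
  from eventually_div_sqrt_small[OF this, of s] show ?thesis
  proof eventually_elim
    case (elim n)
    hence "- p < s / sqrt n" "s / sqrt n < 1 - p" by linarith+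
    thus ?case by (simp add: bump_def)
  qed
qed

lemma tendsto_bump:
  assumes p: "0 < p" "p < 1"
  shows "(\<lambda>n. bump p n s) \<longlonglongrightarrow> exp (- s\<^sup>2 / (2 * (p * (1 - p))))"
proof -
  have "(\<lambda>n. exp (real n * psi p (s / sqrt n))) \<longlonglongrightarrow> exp (- s\<^sup>2 / (2 * (p * (1 - p))))"
    by (intro tendsto_exp tendsto_psi_scaled p)
  thus ?thesis by (rule Lim_transform_eventually) (use eventually_bump_eq[OF p, of s] in \<open>simp add: eq_commute\<close>)
qed

section \<open>Gaussian integrals and limits under the integral sign\<close>

lemma has_bochner_integral_exp_square:
  fixes c :: real assumes c: "c > 0"
  shows "has_bochner_integral lborel (\<lambda>s. exp (- s\<^sup>2 / (2 * c))) (sqrt (2 * pi * c))"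
proof -
  have "has_bochner_integral lborel (\<lambda>s. sqrt (2 * pi * c) * normal_density 0 (sqrt c) s) (sqrt (2 * pi * c) * 1)"
    using c by (intro has_bochner_integral_mult_right) (auto simp: has_bochner_integral_iff)
  thus ?thesis using c by (simp add: normal_density_def)
qed

lemma integrable_gauss_moment: "integrable lborel (\<lambda>s::real. \<bar>s\<bar> ^ k * exp (- s\<^sup>2 / 2))"
proof -
  have "integrable lborel (\<lambda>s::real. sqrt (2 * pi) * (std_normal_density s * \<bar>s\<bar> ^ k))"
    by (intro integrable_mult_right integrable_std_normal_moment_abs)
  thus ?thesis by (simp add: std_normal_density_def mult.commute)
qed

text \<open>The substitution \<open>s = sqrt (2*c) * t\<close> multiplies the known half-line moment
  1/2 of \<open>t^3 * exp (- t^2)\<close> by \<open>(2*c)^2\<close>.\<close>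

lemma gauss_half_third_moment:
  fixes c :: real assumes c: "c > 0"
  shows "(\<integral>s. indicator {0<..} s * (s^3 * exp (- s\<^sup>2 / (2 * c))) \<partial>lborel) = 2 * c\<^sup>2"
proof -
  have "(\<integral>s. indicator {0<..} s * (s^3 * exp (- s\<^sup>2 / (2 * c))) \<partial>lborel)
      = \<bar>sqrt (2*c)\<bar> * (\<integral>s. indicator {0<..} (0 + sqrt (2*c) * s) * ((0 + sqrt (2*c) * s)^3 * exp (- (0 + sqrt (2*c) * s)\<^sup>2 / (2 * c))) \<partial>lborel)"
    using lborel_integral_real_affine[of "sqrt (2*c)" "\<lambda>s. indicator {0<..} s * (s^3 * exp (- s\<^sup>2 / (2 * c)))" 0] c
    by (simp add: scaleR_conv_of_real)
  also have "(\<lambda>s. indicator {0<..} (0 + sqrt (2*c) * s) * ((0 + sqrt (2*c) * s)^3 * exp (- (0 + sqrt (2*c) * s)\<^sup>2 / (2 * c))))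
     = (\<lambda>s. sqrt (2*c) ^ 3 * (indicator {0..} s *\<^sub>R (exp (- s\<^sup>2) * s ^ (2 * 1 + 1))))"
  proof
    fix s :: real
    have "(0 + sqrt (2*c) * s)\<^sup>2 / (2 * c) = s\<^sup>2" using c by (simp add: power_mult_distrib)
    thus "indicator {0<..} (0 + sqrt (2*c) * s) * ((0 + sqrt (2*c) * s)^3 * exp (- (0 + sqrt (2*c) * s)\<^sup>2 / (2 * c)))
       = sqrt (2*c) ^ 3 * (indicator {0..} s *\<^sub>R (exp (- s\<^sup>2) * s ^ (2 * 1 + 1)))"
      using c by (cases "s = 0") (auto simp: indicator_def power_mult_distrib zero_less_mult_iff)
  qed
  also have "(\<integral>s. sqrt (2*c) ^ 3 * (indicator {0..} s *\<^sub>R (exp (- s\<^sup>2) * s ^ (2 * 1 + 1))) \<partial>lborel) = sqrt (2*c)^3 * (fact 1 / 2)"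
    using has_bochner_integral_integral_eq[OF gaussian_moment_odd_pos[of 1]] by (simp only: integral_mult_right_zero)
  also have "\<bar>sqrt (2*c)\<bar> * (sqrt (2*c)^3 * (fact 1 / 2)) = sqrt (2*c)^4 / 2"
    using c by (simp add: eval_nat_numeral)
  also have "sqrt (2*c)^4 = ((sqrt (2*c))\<^sup>2)\<^sup>2" by (simp flip: power_mult)
  finally show ?thesis using c by (simp add: power_mult_distrib)
qed

lemma tendsto_integral_bump:
  assumes p: "0 < p" "p < 1"
  shows "(\<lambda>n. \<integral>s. bump p n s \<partial>lborel) \<longlonglongrightarrow> sqrt (2 * pi * (p * (1 - p)))"
proof -
  have c: "p * (1 - p) > 0" using p by simp
  \<comment> \<open>The index is shifted because division by zero makes \<open>bump p 0\<close>
    constantly 1, which is not integrable.\<close>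
  have "(\<lambda>n. \<integral>s. bump p (Suc n) s \<partial>lborel) \<longlonglongrightarrow> (\<integral>s. exp (- s\<^sup>2 / (2 * (p * (1 - p)))) \<partial>lborel)"
  proof (rule integral_dominated_convergence)
    show "integrable lborel (\<lambda>s::real. exp (- s\<^sup>2 / 2))"
      using integrable_gauss_moment[of 0] by simp
    show "AE s in lborel. (\<lambda>n. bump p (Suc n) s) \<longlonglongrightarrow> exp (- s\<^sup>2 / (2 * (p * (1 - p))))"
      by (intro AE_I2 LIMSEQ_Suc tendsto_bump p)
    show "AE s in lborel. norm (bump p (Suc n) s) \<le> exp (- s\<^sup>2 / 2)" for n
      using bump_le[OF p, of "Suc n"] by (intro AE_I2) (simp add: bump_nonneg)
  qed auto
  also have "(\<integral>s. exp (- s\<^sup>2 / (2 * (p * (1 - p)))) \<partial>lborel) = sqrt (2 * pi * (p * (1 - p)))"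
    using has_bochner_integral_integral_eq[OF has_bochner_integral_exp_square[OF c]] .
  finally show ?thesis by (rule LIMSEQ_imp_Suc)
qed

text \<open>Both bounds are \<open>1 + x \<le> exp x\<close> with the roles of \<open>a\<close> and
  \<open>b\<close> exchanged. They replace the mean value theorem, with no intermediate point to
  control.\<close>

lemma exp_diff_bounds:
  fixes a b :: real
  shows "(a - b) * exp b \<le> exp a - exp b" and "exp a - exp b \<le> (a - b) * exp a"
proof -
  have 1: "(a - b) * exp b \<le> exp a - exp b" for a b :: real
    using mult_right_mono[OF exp_ge_add_one_self[of "a - b"], of "exp b"]
    by (simp add: exp_diff algebra_simps)
  show "(a - b) * exp b \<le> exp a - exp b" "exp a - exp b \<le> (a - b) * exp a"
    using 1[of a b] 1[of b a] by (simp_all add: algebra_simps)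
qed

text \<open>The exponents at \<open>-s\<close> and \<open>s\<close> have a common limit, and
  \<open>sqrt n\<close> times their difference is \<open>s^3\<close> times the quotient of
  \<open>psi_skew\<close>. The sandwich of \<open>exp_diff_bounds\<close> carries this over to the
  exponentials.\<close>

lemma tendsto_skew:
  assumes p: "0 < p" "p < 1" and s: "s > 0"
  shows "(\<lambda>n. sqrt n * (bump p n (- s) - bump p n s)) \<longlonglongrightarrow>
     2 / 3 * (2*p - 1) / (p * (1 - p))\<^sup>2 * (s^3 * exp (- s\<^sup>2 / (2 * (p * (1 - p)))))"
proof -
  define L where "L = 2 / 3 * (2*p - 1) / (p * (1 - p))\<^sup>2"
  define E where "E = exp (- s\<^sup>2 / (2 * (p * (1 - p))))"
  define a where "a n = real n * psi p (- s / sqrt n)" for n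
  define b where "b n = real n * psi p (s / sqrt n)" for n
  have d: "(\<lambda>n. sqrt n * (a n - b n)) \<longlonglongrightarrow> s^3 * L"
  proof -
    have "(\<lambda>n. s^3 * ((psi p (- (s / sqrt n)) - psi p (s / sqrt n)) / (s / sqrt n)^3)) \<longlonglongrightarrow> s^3 * L"
      unfolding L_def
      by (intro tendsto_intros filterlim_compose[OF psi_skew[OF p]] filterlim_div_sqrt_at_0 s) (use s in simp)
    moreover have "eventually (\<lambda>n. s^3 * ((psi p (- (s / sqrt n)) - psi p (s / sqrt n)) / (s / sqrt n)^3)
        = sqrt n * (a n - b n)) sequentially"
      using eventually_gt_at_top[of 0]
    proof eventually_elim
      case (elim n)
      have "(s / sqrt n)^3 = s^3 / (n * sqrt n)" by (simp add: power_divide power3_eq_cube)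
      thus ?case using s elim by (simp add: a_def b_def right_diff_distrib diff_divide_distrib mult_ac)
    qed
    ultimately show ?thesis by (auto dest: Lim_transform_eventually)
  qed
  have ea: "(\<lambda>n. exp (a n)) \<longlonglongrightarrow> E" and eb: "(\<lambda>n. exp (b n)) \<longlonglongrightarrow> E"
    using tendsto_psi_scaled[OF p, of "-s"] tendsto_psi_scaled[OF p, of s]
    unfolding a_def b_def E_def by (auto intro: tendsto_exp)
  have "(\<lambda>n. sqrt n * (exp (a n) - exp (b n))) \<longlonglongrightarrow> s^3 * L * E"
  proof (rule tendsto_sandwich)
    show "(\<lambda>n. sqrt n * (a n - b n) * exp (b n)) \<longlonglongrightarrow> s^3 * L * E"
      "(\<lambda>n. sqrt n * (a n - b n) * exp (a n)) \<longlonglongrightarrow> s^3 * L * E"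
      by (intro tendsto_mult d ea eb)+
  qed (auto intro!: always_eventually mult_left_mono exp_diff_bounds simp: mult.assoc)
  moreover have "eventually (\<lambda>n. sqrt n * (exp (a n) - exp (b n)) = sqrt n * (bump p n (- s) - bump p n s)) sequentially"
    using eventually_bump_eq[OF p, of s] eventually_bump_eq[OF p, of "-s"]
    by eventually_elim (simp add: a_def b_def)
  ultimately have "(\<lambda>n. sqrt n * (bump p n (- s) - bump p n s)) \<longlonglongrightarrow> s^3 * L * E"
    by (rule Lim_transform_eventually)
  thus ?thesis by (simp add: L_def E_def mult_ac)
qed

text \<open>
  With \<open>u = s / sqrt n\<close>: for \<open>u < \<delta>\<close> the two exponents differ by \<open>O(n u^3)\<close>, and for
  \<open>u \<ge> \<delta>\<close> the factor \<open>sqrt n\<close> is at most \<open>s / \<delta>\<close>.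
\<close>

lemma skew_bound:
  assumes p: "0 < p" "p < 1"
  obtains K \<delta> where "\<delta> > 0"
    "\<And>n s. n > 0 \<Longrightarrow> s > 0 \<Longrightarrow>
      \<bar>sqrt n * (bump p n (- s) - bump p n s)\<bar> \<le> (K * s^3 + s / \<delta>) * exp (- s\<^sup>2 / 2)"
proof -
  define L where "L = 2 / 3 * (2*p - 1) / (p * (1 - p))\<^sup>2"
  define K where "K = \<bar>L\<bar> + 1"
  have "eventually (\<lambda>u. \<bar>(psi p (-u) - psi p u) / u^3\<bar> < K) (at_right 0)"
    by (rule order_tendstoD(2)[OF tendsto_rabs[OF psi_skew[OF p]]]) (simp add: K_def L_def)
  then obtain d where d: "d > 0" "\<And>u. 0 < u \<Longrightarrow> u < d \<Longrightarrow> \<bar>(psi p (-u) - psi p u) / u^3\<bar> < K"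
    by (auto simp: eventually_at_right[of 0 1])
  define \<delta> where "\<delta> = min d (min p (1 - p))"
  have \<delta>: "\<delta> > 0" using d p by (simp add: \<delta>_def)
  show ?thesis
  proof (rule that[OF \<delta>])
    fix n :: nat and s :: real
    assume n: "n > 0" and s: "s > 0"
    define u where "u = s / sqrt n"
    have u: "u > 0" using n s by (simp add: u_def)
    have E: "0 \<le> bump p n x" "bump p n x \<le> exp (- s\<^sup>2 / 2)" if "x = s \<or> x = - s" for x
      using bump_le[OF p n, of x] that by (auto simp: bump_nonneg)
    have K: "K * s^3 \<ge> 0" using s by (simp add: K_def)
    show "\<bar>sqrt n * (bump p n (- s) - bump p n s)\<bar> \<le> (K * s^3 + s / \<delta>) * exp (- s\<^sup>2 / 2)"
    proof (cases "u < \<delta>")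
      case True
      define a b where "a = real n * psi p (- u)" and "b = real n * psi p u"
      have eq: "bump p n s = exp b" "bump p n (- s) = exp a"
        using True u p by (auto simp: bump_def a_def b_def u_def \<delta>_def)
      have "\<bar>exp a - exp b\<bar> \<le> \<bar>a - b\<bar> * max (exp a) (exp b)"
        using exp_diff_bounds(2)[of a b] exp_diff_bounds(2)[of b a]
        by (cases "a \<ge> b") (simp_all add: max_def)
      also have "\<dots> \<le> \<bar>a - b\<bar> * exp (- s\<^sup>2 / 2)"
        using E[of s] E[of "-s"] eq by (intro mult_left_mono) auto
      finally have "\<bar>sqrt n * (bump p n (- s) - bump p n s)\<bar> \<le> sqrt n * \<bar>a - b\<bar> * exp (- s\<^sup>2 / 2)"
        unfolding eq abs_mult mult.assoc by (intro mult_mono) auto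
      moreover have "sqrt n * \<bar>a - b\<bar> \<le> K * s^3"
      proof -
        have "\<bar>psi p (-u) - psi p u\<bar> \<le> K * u^3"
          using d(2)[of u] u True by (simp add: \<delta>_def abs_divide divide_simps split: if_splits)
        hence "sqrt n * (n * \<bar>psi p (-u) - psi p u\<bar>) \<le> sqrt n * (n * (K * u^3))"
          by (intro mult_left_mono) auto
        also have "\<dots> = K * s^3" using n by (simp add: u_def power_divide power3_eq_cube)
        finally show ?thesis by (simp add: a_def b_def abs_mult flip: right_diff_distrib)
      qed
      hence "sqrt n * \<bar>a - b\<bar> * exp (- s\<^sup>2 / 2) \<le> (K * s^3 + s / \<delta>) * exp (- s\<^sup>2 / 2)"
        using s \<delta> by (intro mult_right_mono) (auto intro!: add_increasing2)
      ultimately show ?thesis by (rule order_trans)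
    next
      case False
      have "\<bar>bump p n (- s) - bump p n s\<bar> \<le> exp (- s\<^sup>2 / 2)"
        using E[of s] E[of "-s"] by auto
      moreover have "sqrt n \<le> K * s^3 + s / \<delta>"
      proof -
        have "sqrt n \<le> s / \<delta>"
          using False \<delta> n by (simp add: u_def field_simps not_less)
        thus ?thesis using K by linarith
      qed
      ultimately show ?thesis unfolding abs_mult using K s \<delta> by (intro mult_mono) auto
    qed
  qed
qed

text \<open>The variance drops out: the third moment gives \<open>2 * (p * (1 - p))^2\<close>, which
  cancels the denominator of the cubic coefficient.\<close>

lemma tendsto_integral_skew:
  assumes p: "0 < p" "p < 1"
  shows "(\<lambda>n. \<integral>s. indicator {0<..} s * (sqrt n * (bump p n (- s) - bump p n s)) \<partial>lborel)
     \<longlonglongrightarrow> 4 / 3 * (2*p - 1)"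
proof -
  define L where "L = 2 / 3 * (2*p - 1) / (p * (1 - p))\<^sup>2"
  have c: "p * (1 - p) > 0" using p by simp
  obtain K \<delta> where \<delta>: "\<delta> > 0" and bd: "\<And>n s. n > 0 \<Longrightarrow> s > 0 \<Longrightarrow>
      \<bar>sqrt n * (bump p n (- s) - bump p n s)\<bar> \<le> (K * s^3 + s / \<delta>) * exp (- s\<^sup>2 / 2)"
    by (rule skew_bound[OF p]) (rule that)
  define h where "h n s = indicator {0<..} s * (sqrt n * (bump p n (- s) - bump p n s))" for n s
  \<comment> \<open>\<open>skew_bound\<close> says nothing about the sign of \<open>K\<close>, and a
    majorant must be nonnegative for \<open>s \<le> 0\<close> too, hence the absolute
    values.\<close>
  define w where "w s = \<bar>K\<bar> * (\<bar>s\<bar>^3 * exp (- s\<^sup>2 / 2)) + 1 / \<delta> * (\<bar>s\<bar>^1 * exp (- s\<^sup>2 / 2))" for s :: real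
  have "(\<lambda>n. \<integral>s. h (Suc n) s \<partial>lborel) \<longlonglongrightarrow>
     (\<integral>s. L * (indicator {0<..} s * (s^3 * exp (- s\<^sup>2 / (2 * (p * (1 - p)))))) \<partial>lborel)"
  proof (rule integral_dominated_convergence)
    show "integrable lborel w"
      unfolding w_def by (intro Bochner_Integration.integrable_add integrable_mult_right integrable_gauss_moment)
    show "AE s in lborel. (\<lambda>n. h (Suc n) s) \<longlonglongrightarrow>
        L * (indicator {0<..} s * (s^3 * exp (- s\<^sup>2 / (2 * (p * (1 - p))))))"
    proof (intro AE_I2 LIMSEQ_Suc)
      fix s :: real
      show "(\<lambda>n. h n s) \<longlonglongrightarrow> L * (indicator {0<..} s * (s^3 * exp (- s\<^sup>2 / (2 * (p * (1 - p))))))"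
      proof (cases "s > 0")
        case True
        hence ind: "indicator {0<..} s = (1::real)" by simp
        from tendsto_skew[OF p True] show ?thesis
          unfolding h_def L_def ind mult_1_left .
      qed (simp add: h_def)
    qed
    show "AE s in lborel. norm (h (Suc n) s) \<le> w s" for n
    proof (intro AE_I2)
      fix s :: real
      have w: "w s \<ge> 0" using \<delta> by (simp add: w_def)
      show "norm (h (Suc n) s) \<le> w s"
      proof (cases "s > 0")
        case True
        hence ind: "indicator {0<..} s = (1::real)" by simp
        have "norm (h (Suc n) s) \<le> (K * s^3 + s / \<delta>) * exp (- s\<^sup>2 / 2)"
          using bd[of "Suc n" s, OF zero_less_Suc True]
          unfolding h_def real_norm_def ind mult_1_left .
        also have "\<dots> \<le> (\<bar>K\<bar> * s^3 + s / \<delta>) * exp (- s\<^sup>2 / 2)"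
          using True by (intro mult_right_mono add_right_mono) auto
        also have "\<dots> = w s" using True by (simp add: w_def distrib_right)
        finally show ?thesis .
      qed (use w in \<open>simp add: h_def\<close>)
    qed
    show "h (Suc n) \<in> borel_measurable lborel" for n unfolding h_def by measurable
    show "(\<lambda>s. L * (indicator {0<..} s * (s^3 * exp (- s\<^sup>2 / (2 * (p * (1 - p))))))) \<in> borel_measurable lborel" by measurable
  qed
  also have "(\<integral>s. L * (indicator {0<..} s * (s^3 * exp (- s\<^sup>2 / (2 * (p * (1 - p)))))) \<partial>lborel) = L * (2 * (p * (1 - p))\<^sup>2)"
    by (subst integral_mult_right_zero, subst gauss_half_third_moment[OF c]) simp
  also have "\<dots> = 4 / 3 * (2*p - 1)" using c p by (simp add: L_def)
  finally have "(\<lambda>n. \<integral>s. h n s \<partial>lborel) \<longlonglongrightarrow> 4 / 3 * (2*p - 1)" by (rule LIMSEQ_imp_Suc)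
  thus ?thesis by (simp only: h_def)
qed

subsection \<open>The binomial distribution function at an integer mean\<close>

definition binomial_cdf :: "nat \<Rightarrow> nat \<Rightarrow> real \<Rightarrow> real" where
  "binomial_cdf n k x = (\<Sum>j\<le>k. real (n choose j) * x ^ j * (1 - x) ^ (n - j))"

text \<open>The derivatives of the summands telescope, and what remains is minus the density of
  Beta(\<open>k + 1\<close>, \<open>n - k + 1\<close>). With \<open>Suc n\<close> trials the two
  exponents add up to \<open>n\<close>, so the mode is \<open>k / n\<close>.\<close>

lemma binomial_cdf_deriv:
  assumes "k \<le> n"
  shows "(binomial_cdf (Suc n) k has_real_derivative - (real (Suc n * (n choose k)) * (x ^ k * (1 - x) ^ (n - k)))) (at x)"
  using assms
proof (induction k)
  case 0
  have "((\<lambda>x. (1 - x) ^ Suc n) has_real_derivative - (real (Suc n) * (1 - x) ^ n)) (at x)"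
  proof -
    have "((\<lambda>x. 1 - x) has_real_derivative - 1) (at x)" by (auto intro!: derivative_eq_intros)
    from DERIV_power_Suc[OF this, of n] show ?thesis by simp
  qed
  thus ?case by (simp add: binomial_cdf_def[abs_def])
next
  case (Suc k)
  define m where "m = n - Suc k"
  have m: "n - k = Suc m" "Suc n - Suc k = Suc m" "n - Suc k = m" using Suc.prems by (auto simp: m_def)
  \<comment> \<open>By these absorption identities one half of the new summand's derivative cancels
    the expression for \<open>k\<close> and the other half is the expression for
    \<open>Suc k\<close>.\<close>
  have b1: "real (Suc k) * real (Suc n choose Suc k) = real (Suc n) * real (n choose k)"
    by (metis Suc_times_binomial_eq mult.commute of_nat_mult)
  have b2: "real (Suc m) * real (Suc n choose Suc k) = real (Suc n) * real (n choose Suc k)"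
  proof -
    have "Suc n - Suc k = Suc m" by (rule m)
    hence "Suc m * (Suc n choose Suc k) = Suc n * (n choose Suc k)"
      using binomial_absorb_comp[of "Suc n" "Suc k"] by simp
    thus ?thesis by (metis of_nat_mult)
  qed
  have d: "((\<lambda>x. real (Suc n choose Suc k) * (x ^ Suc k * (1 - x) ^ Suc m)) has_real_derivative
      real (Suc n choose Suc k) * (real (Suc k) * x ^ k * (1 - x) ^ Suc m - real (Suc m) * (1 - x) ^ m * x ^ Suc k)) (at x)"
  proof (rule DERIV_cmult)
    have "((\<lambda>x. 1 - x) has_real_derivative - 1) (at x)" by (auto intro!: derivative_eq_intros)
    from DERIV_mult[OF DERIV_power_Suc[OF DERIV_ident, of k x UNIV] DERIV_power_Suc[OF this, of m]]
    show "((\<lambda>x. x ^ Suc k * (1 - x) ^ Suc m) has_real_derivative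
      real (Suc k) * x ^ k * (1 - x) ^ Suc m - real (Suc m) * (1 - x) ^ m * x ^ Suc k) (at x)"
      by (simp add: mult_ac)
  qed
  have eq: "real (Suc n choose Suc k) * (real (Suc k) * x ^ k * (1 - x) ^ Suc m - real (Suc m) * (1 - x) ^ m * x ^ Suc k)
     = real (Suc n) * real (n choose k) * (x ^ k * (1 - x) ^ Suc m) - real (Suc n) * real (n choose Suc k) * (x ^ Suc k * (1 - x) ^ m)"
    unfolding b1[symmetric] b2[symmetric] by (simp only: right_diff_distrib mult_ac)
  have IH: "(binomial_cdf (Suc n) k has_real_derivative - (real (Suc n * (n choose k)) * (x ^ k * (1 - x) ^ Suc m))) (at x)"
    using Suc by (simp add: m)
  have "(\<lambda>x. binomial_cdf (Suc n) k x + real (Suc n choose Suc k) * (x ^ Suc k * (1 - x) ^ Suc m))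
      = binomial_cdf (Suc n) (Suc k)"
    unfolding binomial_cdf_def sum.atMost_Suc m by (simp only: mult.assoc)
  from DERIV_add[OF IH d[unfolded eq], unfolded this] show ?case
    by (rule DERIV_cong) (simp add: m algebra_simps)
qed

lemma binomial_cdf_0: "binomial_cdf n k 0 = 1"
  unfolding binomial_cdf_def by (subst sum.remove[of _ 0]) (auto intro!: sum.neutral)

lemma binomial_cdf_1: "k < n \<Longrightarrow> binomial_cdf n k 1 = 0"
  unfolding binomial_cdf_def by (intro sum.neutral) auto

lemma bump_eq:
  fixes s :: real
  assumes p: "0 < p" "p < 1" and n: "n > 0" and k: "real k = p * n"
  defines "x \<equiv> p + s / sqrt n"
  shows "x ^ k * (1 - x) ^ (n - k) * indicator {0..1} x = p ^ k * (1 - p) ^ (n - k) * bump p n s"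
proof -
  have "p * n < 1 * real n" using p n by (intro mult_strict_right_mono) auto
  hence kn: "k < n" using k by (metis mult_1 of_nat_less_iff)
  have "p * n > 0" using p n by simp
  hence k0: "k > 0" using k by (metis of_nat_0_less_iff)
  have nk: "real (n - k) = (1 - p) * n" using kn k by (simp add: of_nat_diff algebra_simps)
  define u where "u = s / sqrt n"
  \<comment> \<open>The indicator belongs to the closed interval and \<open>bump\<close> to the open
    one; at the endpoints both sides vanish because \<open>0 < k < n\<close>.\<close>
  consider "x < 0 \<or> 1 < x" | "x = 0" | "x = 1" | "0 < x" "x < 1" by linarith
  thus ?thesis
  proof cases
    case 4
    hence u: "- p < u" "u < 1 - p" by (auto simp: x_def u_def)
    hence u': "1 + u / p > 0" "1 - u / (1 - p) > 0" using p by (auto simp: field_simps)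
    have "exp (n * psi p u) = exp (real k * ln (1 + u / p) + real (n - k) * ln (1 - u / (1 - p)))"
      by (simp only: psi_def k nk) (simp add: algebra_simps)
    also have "\<dots> = (1 + u / p) ^ k * (1 - u / (1 - p)) ^ (n - k)"
      using u' by (simp add: exp_add exp_of_nat_mult)
    finally have e: "exp (n * psi p u) = (1 + u / p) ^ k * (1 - u / (1 - p)) ^ (n - k)" .
    have "x = p * (1 + u / p)" "1 - x = (1 - p) * (1 - u / (1 - p))"
      using p by (simp_all add: x_def distrib_left right_diff_distrib flip: u_def)
    hence "x ^ k * (1 - x) ^ (n - k) = p ^ k * (1 - p) ^ (n - k) * exp (n * psi p u)"
      unfolding e by (metis (no_types, opaque_lifting) power_mult_distrib mult.assoc mult.left_commute)
    thus ?thesis using 4 u by (simp add: bump_def u_def)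
  qed (use k0 kn in \<open>auto simp: x_def bump_def\<close>)
qed

lemma integrable_bump:
  assumes p: "0 < p" "p < 1" and n: "n > 0"
  shows "integrable lborel (bump p n)"
proof (rule Bochner_Integration.integrable_bound)
  show "integrable lborel (\<lambda>s::real. exp (- s\<^sup>2 / 2))"
    using integrable_gauss_moment[of 0] by simp
  show "AE s in lborel. norm (bump p n s) \<le> norm (exp (- s\<^sup>2 / 2))"
    using bump_le[OF p n] bump_nonneg[of p n] by (intro AE_I2) simp
qed simp

text \<open>The distribution function falls from 1 at \<open>x = 0\<close> to 0 at
  \<open>x = 1\<close>, so its value at \<open>p\<close> is the share of the beta mass to the right
  of \<open>p\<close>. The left side is therefore the left share minus the right share, and the
  factors \<open>c\<close> and \<open>D\<close> cancel.\<close>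

lemma binomial_cdf_skew:
  assumes p: "0 < p" "p < 1" and n: "n > 0" and k: "real k = p * n"
  shows "1 - 2 * binomial_cdf (Suc n) k p
    = (\<integral>s. indicator {0<..} s * (bump p n (- s) - bump p n s) \<partial>lborel) / (\<integral>s. bump p n s \<partial>lborel)"
proof -
  define f where "f x = x ^ k * (1 - x) ^ (n - k)" for x :: real
  define c where "c = real (Suc n * (n choose k))"
  define D where "D = p ^ k * (1 - p) ^ (n - k) / sqrt n"
  have "p * n \<le> 1 * real n" using p n by (intro mult_right_mono) auto
  hence kn: "k \<le> n" using k by simp
  have c: "c > 0" unfolding c_def of_nat_0_less_iff using kn by simp
  define H where "H x = - binomial_cdf (Suc n) k x / c" for x
  have der: "(H has_real_derivative f x) (at x)" for x
    unfolding H_def f_def using c binomial_cdf_deriv[OF kn, of x, folded c_def]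
    by (auto intro!: derivative_eq_intros)
  have ftc: "(\<integral>x. f x * indicator {a..b} x \<partial>lborel) = H b - H a" if "a \<le> b" for a b
    by (rule integral_FTC_Icc_real[OF that der]) (auto simp: f_def intro!: continuous_intros)
  have shift: "(\<integral>x. g x \<partial>lborel) = (\<integral>s. g (p + s / sqrt n) \<partial>lborel) / sqrt n" for g :: "real \<Rightarrow> real"
    using lborel_integral_real_affine[of "1 / sqrt n" g p] n by simp
  have eq: "f (p + s / sqrt n) * indicator {0..1} (p + s / sqrt n) = sqrt n * D * bump p n s" for s
    using bump_eq[OF p n k, of s] n by (simp add: f_def D_def)
  have *: "(\<integral>x. f x * (indicator {0..1} x * indicator A x) \<partial>lborel)
      = D * (\<integral>s. indicator A (p + s / sqrt n) * bump p n s \<partial>lborel)" for A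
  proof -
    have "(\<integral>x. f x * (indicator {0..1} x * indicator A x) \<partial>lborel)
        = (\<integral>s. f (p + s / sqrt n) * (indicator {0..1} (p + s / sqrt n) * indicator A (p + s / sqrt n)) \<partial>lborel) / sqrt n"
      by (rule shift)
    also have "(\<lambda>s. f (p + s / sqrt n) * (indicator {0..1} (p + s / sqrt n) * indicator A (p + s / sqrt n)))
        = (\<lambda>s. sqrt n * D * (indicator A (p + s / sqrt n) * bump p n s))"
      by (rule ext) (simp only: mult.assoc[symmetric] eq, simp only: mult_ac)
    finally show ?thesis using n by simp
  qed
  have "H 1 - H 0 = D * (\<integral>s. bump p n s \<partial>lborel)"
    using *[of UNIV] ftc[of 0 1] by simp
  moreover have "H 1 - H 0 = 1 / c" using kn by (simp add: H_def binomial_cdf_0 binomial_cdf_1)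
  ultimately have "D * (\<integral>s. bump p n s \<partial>lborel) = 1 / c" by simp
  hence one: "c * (D * (\<integral>s. bump p n s \<partial>lborel)) = 1"
    using c by simp
  have A: "1 - binomial_cdf (Suc n) k p = c * (D * (\<integral>s. indicator {0..} s * bump p n (- s) \<partial>lborel))"
  proof -
    have ind: "indicator {0..1} x * indicator {..p} x = (indicator {0..p} x :: real)" for x
      using p by (auto simp: indicator_def)
    have "H p - H 0 = D * (\<integral>s. indicator {..p} (p + s / sqrt n) * bump p n s \<partial>lborel)"
      using *[of "{..p}", unfolded ind] ftc[of 0 p] p by simp
    also
    have "(\<lambda>s. indicator {..p} (p + s / sqrt n)) = (indicator {..0} :: real \<Rightarrow> real)"
      using n by (auto simp: indicator_def fun_eq_iff divide_le_0_iff)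
    hence "(\<lambda>s. indicator {..p} (p + s / sqrt n) * bump p n s) = (\<lambda>s. indicator {..0} s * bump p n s)"
      by (simp add: fun_eq_iff)
    also have "(\<integral>s. indicator {..0} s * bump p n s \<partial>lborel) = (\<integral>s. indicator {..0} (- s) * bump p n (- s) \<partial>lborel)"
      using lborel_integral_real_affine[of "-1" "\<lambda>s. indicator {..0} s * bump p n s" 0] by simp
    also have "(\<lambda>s. indicator {..0} (- s) * bump p n (- s)) = (\<lambda>s. indicator {0..} s * bump p n (- s))"
      by (auto simp: indicator_def)
    finally show ?thesis using c by (simp add: H_def binomial_cdf_0 field_simps)
  qed
  have B: "binomial_cdf (Suc n) k p = c * (D * (\<integral>s. indicator {0..} s * bump p n s \<partial>lborel))"
  proof -
    have ind: "indicator {0..1} x * indicator {p..} x = (indicator {p..1} x :: real)" for x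
      using p by (auto simp: indicator_def)
    have "H 1 - H p = D * (\<integral>s. indicator {p..} (p + s / sqrt n) * bump p n s \<partial>lborel)"
      using *[of "{p..}", unfolded ind] ftc[of p 1] p by simp
    also
    have "(\<lambda>s. indicator {p..} (p + s / sqrt n)) = (indicator {0..} :: real \<Rightarrow> real)"
      using n by (auto simp: indicator_def fun_eq_iff zero_le_divide_iff)
    hence "(\<lambda>s. indicator {p..} (p + s / sqrt n) * bump p n s) = (\<lambda>s. indicator {0..} s * bump p n s)"
      by (simp add: fun_eq_iff)
    finally show ?thesis using c kn by (simp add: H_def binomial_cdf_1 field_simps)
  qed
  have int: "integrable lborel (\<lambda>s. indicator {0..} s * bump p n s)"
    using integrable_mult_indicator[OF _ integrable_bump[OF p n], of "{0..}"] by simp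
  have "integrable lborel (\<lambda>s. bump p n (0 + -1 * s))"
    by (rule lborel_integrable_real_affine[OF integrable_bump[OF p n]]) simp
  from integrable_mult_indicator[OF _ this, of "{0..}"]
  have int': "integrable lborel (\<lambda>s. indicator {0..} s * bump p n (- s))" by simp
  have "(\<integral>s. indicator {0<..} s * (bump p n (- s) - bump p n s) \<partial>lborel)
      = (\<integral>s. indicator {0..} s * bump p n (- s) - indicator {0..} s * bump p n s \<partial>lborel)"
    by (intro Bochner_Integration.integral_cong refl) (auto simp: indicator_def)
  also have "\<dots> = (\<integral>s. indicator {0..} s * bump p n (- s) \<partial>lborel) - (\<integral>s. indicator {0..} s * bump p n s \<partial>lborel)"
    by (rule Bochner_Integration.integral_diff[OF int' int])
  \<comment> \<open>Inserting the factor 1 from \<open>one\<close> supplies the \<open>c * D\<close>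
    by which \<open>A\<close> and \<open>B\<close> recognise the two half-line integrals.\<close>
  also have "\<dots> = (c * D * (\<integral>s. bump p n s \<partial>lborel)) * \<dots>" using one by (simp add: mult.assoc)
  also have "\<dots> = ((1 - binomial_cdf (Suc n) k p) - binomial_cdf (Suc n) k p) * (\<integral>s. bump p n s \<partial>lborel)"
    unfolding A unfolding B by (simp add: algebra_simps)
  finally have "(\<integral>s. indicator {0<..} s * (bump p n (- s) - bump p n s) \<partial>lborel)
      = (1 - 2 * binomial_cdf (Suc n) k p) * (\<integral>s. bump p n s \<partial>lborel)" by simp
  moreover have "(\<integral>s. bump p n s \<partial>lborel) \<noteq> 0" using one by auto
  ultimately show ?thesis by (simp add: eq_divide_eq)
qed

subsection \<open>Two-point distributions\<close>

text \<open>A push-forward of a pmf, so that products pass to \<open>Pi_pmf\<close> and the number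
  of successes to \<open>binomial_pmf\<close>.\<close>

definition two_point :: "real \<Rightarrow> real measure" where
  "two_point p = distr (measure_pmf (bernoulli_pmf p)) borel (\<lambda>b. of_bool b - p)"

lemma sets_two_point [measurable_cong, simp]: "sets (two_point p) = sets borel"
  by (simp add: two_point_def)

lemma space_two_point [simp]: "space (two_point p) = UNIV"
  by (simp add: two_point_def)

lemma prob_space_two_point: "prob_space (two_point p)"
  unfolding two_point_def by (rule measure_pmf.prob_space_distr) simp

lemma integrable_two_point:
  fixes f :: "real \<Rightarrow> real"
  assumes "f \<in> borel_measurable borel"
  shows "integrable (two_point p) f"
  unfolding two_point_def using assms
  by (subst integrable_distr_eq) (auto intro!: integrable_measure_pmf_finite)

lemma integral_two_point:
  fixes f :: "real \<Rightarrow> real"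
  assumes "f \<in> borel_measurable borel" and p: "0 < p" "p < 1"
  shows "(\<integral>x. f x \<partial>two_point p) = p * f (1 - p) + (1 - p) * f (- p)"
  unfolding two_point_def using assms
  by (subst integral_distr) (auto simp: integral_bernoulli_pmf)

lemma two_point_in_distF:
  assumes p: "0 < p" "p < 1"
  shows "two_point p \<in> distF"
proof -
  have "two_point p \<noteq> return borel c" for c
  proof
    assume *: "two_point p = return borel c"
    have "(\<integral>x. (x - c)\<^sup>2 \<partial>two_point p) = 0" unfolding * by (subst integral_return) auto
    hence "p * (1 - p - c)\<^sup>2 + (1 - p) * (- p - c)\<^sup>2 = 0" using p by (simp add: integral_two_point)
    moreover have "p * (1 - p - c)\<^sup>2 \<ge> 0" "(1 - p) * (- p - c)\<^sup>2 \<ge> 0" using p by auto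
    ultimately have "p * (1 - p - c)\<^sup>2 = 0" "(1 - p) * (- p - c)\<^sup>2 = 0" by linarith+
    thus False using p by auto
  qed
  thus ?thesis
    using p by (auto simp: distF_def prob_space_two_point integral_two_point algebra_simps intro!: integrable_two_point)
qed

lemma sigma1sq_two_point: "0 < p \<Longrightarrow> p < 1 \<Longrightarrow> sigma1sq (two_point p) = p * (1 - p)"
  by (simp add: sigma1sq_def integral_two_point power2_eq_square algebra_simps)

text \<open>A product measure is determined by its values on boxes, and the preimage of a box is a
  box of outcomes, whose probability factorises.\<close>

lemma PiM_two_point:
  assumes "finite I"
  shows "PiM I (\<lambda>_. two_point p) =
    distr (measure_pmf (Pi_pmf I False (\<lambda>_. bernoulli_pmf p))) (PiM I (\<lambda>_. borel)) (\<lambda>b. \<lambda>i\<in>I. of_bool (b i) - p)"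
    (is "_ = ?D")
proof -
  interpret product_sigma_finite "\<lambda>_. two_point p"
    using prob_space_two_point by (intro product_sigma_finite.intro prob_space_imp_sigma_finite)
  show ?thesis
  proof (rule PiM_eqI[OF assms, symmetric])
    show "sets ?D = sets (PiM I (\<lambda>_. two_point p))"
      by (simp cong: sets_PiM_cong)
    fix A assume A: "\<And>i. i \<in> I \<Longrightarrow> A i \<in> sets (two_point p)"
    have "emeasure ?D (Pi\<^sub>E I A) = emeasure (measure_pmf (Pi_pmf I False (\<lambda>_. bernoulli_pmf p)))
        ((\<lambda>b. \<lambda>i\<in>I. of_bool (b i) - p) -` Pi\<^sub>E I A)"
      using A assms by (subst emeasure_distr) (auto intro!: sets_PiM_I_finite measurable_restrict simp: space_PiM)
    also have "(\<lambda>b. \<lambda>i\<in>I. of_bool (b i) - p) -` Pi\<^sub>E I A = Pi I (\<lambda>i. {x. of_bool x - p \<in> A i})"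
      by (rule set_eqI) (simp add: PiE_iff Pi_iff)
    also have "emeasure (measure_pmf (Pi_pmf I False (\<lambda>_. bernoulli_pmf p))) \<dots>
        = ennreal (\<Prod>i\<in>I. measure_pmf.prob (bernoulli_pmf p) {x. of_bool x - p \<in> A i})"
      by (simp add: measure_pmf.emeasure_eq_measure measure_Pi_pmf_Pi[OF assms])
    also have "\<dots> = (\<Prod>i\<in>I. emeasure (measure_pmf (bernoulli_pmf p)) {x. of_bool x - p \<in> A i})"
      by (simp add: measure_pmf.emeasure_eq_measure prod_ennreal)
    also have "\<dots> = (\<Prod>i\<in>I. emeasure (two_point p) (A i))"
      using A by (intro prod.cong refl) (auto simp: two_point_def emeasure_distr vimage_def)
    finally show "emeasure ?D (Pi\<^sub>E I A) = (\<Prod>i\<in>I. emeasure (two_point p) (A i))" .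
  qed
qed

text \<open>The threshold matters only through the lattice points below it; the hypothesis
  \<open>m\<close> isolates this, leaving a count of successes.\<close>

lemma prob_sum_two_point:
  fixes p B x :: real
  assumes p: "0 < p" "p < 1" and m: "\<And>j. j \<le> n \<Longrightarrow> (real j - n * p) / B < x \<longleftrightarrow> j \<le> k" and k: "k \<le> n"
  shows "measure (iidM (two_point p) n) {\<omega> \<in> space (iidM (two_point p) n). (\<Sum>i<n. \<omega> i) / B < x} = binomial_cdf n k p"
proof -
  let ?P = "Pi_pmf {..<n} False (\<lambda>_. bernoulli_pmf p)"
  let ?f = "\<lambda>b. \<lambda>i\<in>{..<n}. of_bool (b i) - p"
  have sp: "space (iidM (two_point p) n) = space (PiM {..<n} (\<lambda>_. borel :: real measure))"
    by (simp add: iidM_def space_PiM)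
  have "measure (iidM (two_point p) n) {\<omega> \<in> space (iidM (two_point p) n). (\<Sum>i<n. \<omega> i) / B < x}
     = measure_pmf.prob ?P (?f -` {\<omega> \<in> space (PiM {..<n} (\<lambda>_. borel)). (\<Sum>i<n. \<omega> i) / B < x})"
    unfolding sp unfolding iidM_def PiM_two_point[OF finite_lessThan]
    by (subst measure_distr) (auto intro!: measurable_restrict simp: space_PiM)
  also have "?f -` {\<omega> \<in> space (PiM {..<n} (\<lambda>_. borel)). (\<Sum>i<n. \<omega> i) / B < x}
     = (\<lambda>b. card {i \<in> {..<n}. b i}) -` {..k}"
  proof -
    have "(\<Sum>i<n. ?f b i) / B < x \<longleftrightarrow> card {i \<in> {..<n}. b i} \<le> k" for b
    proof -
      have "(\<Sum>i<n. ?f b i) = (\<Sum>i<n. of_bool (b i)) - n * p"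
        by (simp add: sum_subtractf)
      also have "(\<Sum>i<n. of_bool (b i)) = real (card {i \<in> {..<n}. b i})"
        by (simp add: of_bool_def sum.If_cases Int_def)
      moreover have "card {i \<in> {..<n}. b i} \<le> n"
        using card_mono[of "{..<n}" "{i \<in> {..<n}. b i}"] by auto
      ultimately show ?thesis using m by simp
    qed
    thus ?thesis by (auto simp: space_PiM)
  qed
  also have "measure_pmf.prob ?P \<dots> = measure_pmf.prob (binomial_pmf n p) {..k}"
    using p by (subst binomial_pmf_altdef'[of "{..<n}" n p False]) auto
  also have "\<dots> = (\<Sum>j\<le>k. pmf (binomial_pmf n p) j)"
    by (simp add: measure_measure_pmf_finite)
  also have "\<dots> = binomial_cdf n k p"
    unfolding binomial_cdf_def using p by (simp add: pmf_binomial)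
  finally show ?thesis .
qed

section \<open>Lower asymptotics of the discrepancy for two-point distributions\<close>

lemma Delta_ge:
  assumes "prob_space F"
  shows "\<bar>measure (iidM F n) {\<omega> \<in> space (iidM F n). (\<Sum>i<n. \<omega> i) / Bn F n < x} - Phi x\<bar> \<le> Delta F n"
  unfolding Delta_def
proof (rule cSUP_upper)
  have P: "prob_space (iidM F n)" unfolding iidM_def by (intro prob_space_PiM assms)
  \<comment> \<open>The supremum in \<open>Delta\<close> is a real one, so it dominates its members
    only once boundedness is known.\<close>
  show "bdd_above (range (\<lambda>x. \<bar>measure (iidM F n) {\<omega> \<in> space (iidM F n). (\<Sum>i<n. \<omega> i) / Bn F n < x} - Phi x\<bar>))"
  proof (rule bdd_aboveI2)
    fix x
    have "0 \<le> Phi x" "Phi x \<le> 1" by (auto simp: Phi_def std_normal.prob_le_1)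
    moreover have "measure (iidM F n) {\<omega> \<in> space (iidM F n). (\<Sum>i<n. \<omega> i) / Bn F n < x} \<le> 1"
      by (rule prob_space.prob_le_1[OF P])
    moreover have "measure (iidM F n) {\<omega> \<in> space (iidM F n). (\<Sum>i<n. \<omega> i) / Bn F n < x} \<ge> 0"
      by simp
    ultimately show "\<bar>measure (iidM F n) {\<omega> \<in> space (iidM F n). (\<Sum>i<n. \<omega> i) / Bn F n < x} - Phi x\<bar> \<le> 1"
      by linarith
  qed
qed simp

text \<open>
  For \<open>n + 1\<close> trials the point \<open>(1 - p) / B\<close> is the standardised lattice point \<open>k + 1\<close>, as
  \<open>k + 1 - (n + 1) p = 1 - p\<close>; evaluating there includes the jump at \<open>k + 1\<close> in the discrepancy.
\<close>

lemma Delta_two_point_ge: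
  assumes p: "0 < p" "p < 1" and n: "n > 0" and k: "real k = p * n"
  defines "B \<equiv> Bn (two_point p) (Suc n)"
  shows "B * Delta (two_point p) (Suc n) \<ge>
    (1 - p) * std_normal_density ((1 - p) / B) + B * (1 - 2 * binomial_cdf (Suc n) k p) / 2"
proof -
  have B: "B > 0" using p by (simp add: B_def Bn_def sigma1sq_two_point)
  have "p * n \<le> 1 * real n" using p n by (intro mult_right_mono) auto
  hence kn: "k \<le> Suc n" using k by simp
  have "measure (iidM (two_point p) (Suc n)) {\<omega> \<in> space (iidM (two_point p) (Suc n)). (\<Sum>i<Suc n. \<omega> i) / B < (1 - p) / B}
     = binomial_cdf (Suc n) k p"
  proof (rule prob_sum_two_point[OF p _ kn])
    fix j :: nat
    have "(real j - Suc n * p) / B < (1 - p) / B \<longleftrightarrow> real j - Suc n * p < 1 - p"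
      using B by (simp add: divide_less_cancel)
    also have "\<dots> \<longleftrightarrow> real j < real k + 1" by (simp add: k algebra_simps)
    also have "\<dots> \<longleftrightarrow> j \<le> k" by linarith
    finally show "(real j - real (Suc n) * p) / B < (1 - p) / B \<longleftrightarrow> j \<le> k" .
  qed
  with Delta_ge[OF prob_space_two_point, of p "Suc n" "(1 - p) / B"]
  have "Delta (two_point p) (Suc n) \<ge> Phi ((1 - p) / B) - binomial_cdf (Suc n) k p"
    by (simp add: B_def)
  moreover have "Phi ((1 - p) / B) \<ge> 1/2 + (1 - p) / B * std_normal_density ((1 - p) / B)"
    using p B by (intro Phi_ge) simp
  ultimately have "Delta (two_point p) (Suc n) \<ge> (1 - p) / B * std_normal_density ((1 - p) / B) + (1 - 2 * binomial_cdf (Suc n) k p) / 2"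
    by (simp add: diff_divide_distrib)
  from mult_left_mono[OF this, of B] B show ?thesis by (simp add: distrib_left)
qed

lemma Bn_two_point:
  "0 < p \<Longrightarrow> p < 1 \<Longrightarrow> Bn (two_point p) n = sqrt (p * (1 - p)) * sqrt n"
  by (simp add: Bn_def sigma1sq_two_point real_sqrt_mult mult.commute)

text \<open>Integrality of \<open>p * n\<close> restricts \<open>n\<close> to multiples of the
  denominator of \<open>p\<close>, hence a subsequence. A limit superior can be bounded from below
  along it, and a convergent minorant \<open>x\<close> is enough.\<close>

lemma Delta_two_point_asymp:
  assumes p: "0 < p" "p < 1" "p \<in> \<rat>"
  obtains r :: "nat \<Rightarrow> nat" and x :: "nat \<Rightarrow> real" where "strict_mono r"
    "\<And>j. x j \<le> Bn (two_point p) (r j) * Delta (two_point p) (r j)"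
    "x \<longlonglongrightarrow> (p + 1) / (3 * sqrt (2 * pi))"
proof -
  from \<open>p \<in> \<rat>\<close> obtain a b :: int where ab: "b > 0" "p = a / b"
    by (rule Rats_cases')
  hence a: "a > 0" using p by (simp add: zero_less_divide_iff)
  \<comment> \<open>Multiples of the denominator; \<open>Suc\<close> excludes the multiple
    0.\<close>
  define N where "N j = nat b * Suc j" for j
  define K where "K j = nat a * Suc j" for j
  have NK: "N j > 0" "real (K j) = p * N j" for j
    using ab a by (auto simp: N_def K_def field_simps)
  define r where "r j = Suc (N j)" for j
  have N: "strict_mono N" using ab by (auto simp: strict_mono_Suc_iff N_def)
  have r: "strict_mono r" using N by (auto simp: strict_mono_Suc_iff r_def)
  define B where "B j = Bn (two_point p) (r j)" for j
  define sk where "sk n = (\<integral>s. indicator {0<..} s * (sqrt n * (bump p n (- s) - bump p n s)) \<partial>lborel)" for n :: nat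
  define it where "it n = (\<integral>s. bump p n s \<partial>lborel)" for n :: nat
  define y where "y n = (1 - p) * std_normal_density ((1 - p) / (sqrt (p * (1 - p)) * sqrt (Suc n)))
      + sqrt (p * (1 - p)) * sqrt (Suc n) / sqrt n * (sk n / it n) / 2" for n :: nat
  have c: "p * (1 - p) > 0" using p by simp
  define S where "S = sqrt (p * (1 - p))"
  have S: "S > 0" using c by (simp add: S_def)
  have it: "it \<longlonglongrightarrow> sqrt (2 * pi * (p * (1 - p)))"
    unfolding it_def by (rule tendsto_integral_bump[OF p(1,2)])
  have sk: "sk \<longlonglongrightarrow> 4 / 3 * (2*p - 1)"
    unfolding sk_def by (rule tendsto_integral_skew[OF p(1,2)])
  have le: "y (N j) \<le> B j * Delta (two_point p) (r j)" for j
  proof -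
    have "sk (N j) = sqrt (N j) * (\<integral>s. indicator {0<..} s * (bump p (N j) (- s) - bump p (N j) s) \<partial>lborel)"
      unfolding sk_def integral_mult_right_zero[symmetric]
      by (intro Bochner_Integration.integral_cong refl) (simp add: mult_ac)
    hence "1 - 2 * binomial_cdf (Suc (N j)) (K j) p = sk (N j) / sqrt (N j) / it (N j)"
      using binomial_cdf_skew[OF p(1,2) NK, of j] NK(1)[of j] by (simp add: it_def)
    with Delta_two_point_ge[OF p(1,2) NK, of j] show ?thesis
      by (simp add: y_def B_def r_def Bn_two_point p)
  qed
  have "y \<longlonglongrightarrow> (1 - p) * std_normal_density 0 + S * 1 * (4 / 3 * (2*p - 1) / sqrt (2 * pi * (p * (1 - p)))) / 2"
  proof -
    have "(\<lambda>n. (1 - p) / (S * sqrt (Suc n))) \<longlonglongrightarrow> 0" using S by real_asymp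
    hence "(\<lambda>n. std_normal_density ((1 - p) / (S * sqrt (Suc n)))) \<longlonglongrightarrow> std_normal_density 0"
    proof (rule isCont_tendsto_compose[rotated])
      show "isCont std_normal_density 0"
        unfolding std_normal_density_def by (intro continuous_intros) simp
    qed
    moreover have "(\<lambda>n. sqrt (Suc n) / sqrt n) \<longlonglongrightarrow> 1" by real_asymp
    ultimately show ?thesis
      unfolding y_def S_def[symmetric] times_divide_eq_right[symmetric, of S] using c
      by (intro tendsto_intros sk it) auto
  qed
  also have "(1 - p) * std_normal_density 0 + S * 1 * (4 / 3 * (2*p - 1) / sqrt (2 * pi * (p * (1 - p)))) / 2
      = (p + 1) / (3 * sqrt (2 * pi))"
  proof -
    have R: "sqrt (2 * pi) \<noteq> 0" by simp
    have "sqrt (2 * pi * (p * (1 - p))) = sqrt (2 * pi) * S"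
      by (simp only: S_def real_sqrt_mult)
    moreover have "std_normal_density 0 = 1 / sqrt (2 * pi)"
      by (simp add: std_normal_density_def)
    ultimately show ?thesis using S R by (simp only:) (simp add: field_simps)
  qed
  finally have "(\<lambda>j. y (N j)) \<longlonglongrightarrow> (p + 1) / (3 * sqrt (2 * pi))"
    using LIMSEQ_subseq_LIMSEQ[OF _ N, of y] by (simp add: comp_def)
  from that[OF r le[unfolded B_def] this] show ?thesis .
qed

text \<open>The denominator \<open>L\<close> is left abstract so that \<open>L_E\<close> and
  \<open>L_R\<close> are both covered. Its positivity matters: a quotient by 0 would be 0.\<close>

lemma limsup_two_point_ge:
  assumes p: "0 < p" "p < 1" "p \<in> \<rat>" and C: "C > 0"
  assumes L: "eventually (\<lambda>n. 0 < L n \<and> L n \<le> C / Bn (two_point p) n) sequentially"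
  shows "limsup (\<lambda>n. ereal (Delta (two_point p) n / L n)) \<ge> ereal ((p + 1) / (3 * sqrt (2 * pi)) / C)"
proof -
  obtain r x where r: "strict_mono r" and x: "\<And>j. x j \<le> Bn (two_point p) (r j) * Delta (two_point p) (r j)"
    and lim: "x \<longlonglongrightarrow> (p + 1) / (3 * sqrt (2 * pi))"
    by (rule Delta_two_point_asymp[OF p]) (rule that)
  have "eventually (\<lambda>j. 0 < L (r j) \<and> L (r j) \<le> C / Bn (two_point p) (r j)) sequentially"
    using eventually_subseq[OF r L] by (simp add: o_def)
  \<comment> \<open>Makes \<open>Delta\<close> nonnegative there, so that replacing \<open>L\<close>
    by its upper bound can only lower the quotient.\<close>
  moreover have "eventually (\<lambda>j. x j > 0) sequentially"
    using p by (intro order_tendstoD(1)[OF lim]) simp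
  ultimately have ev: "eventually (\<lambda>j. ereal (x j / C) \<le> ereal (Delta (two_point p) (r j) / L (r j))) sequentially"
    using eventually_gt_at_top[of 0]
  proof eventually_elim
    case (elim j)
    have "r j > 0" using strict_mono_imp_increasing[OF r, of j] elim by simp
    hence B: "Bn (two_point p) (r j) > 0" using p by (simp add: Bn_two_point)
    have D: "Delta (two_point p) (r j) \<ge> x j / Bn (two_point p) (r j)"
      using x[of j] B by (simp add: field_simps)
    have "x j / C = (x j / Bn (two_point p) (r j)) / (C / Bn (two_point p) (r j))"
      using B by simp
    also have "\<dots> \<le> Delta (two_point p) (r j) / L (r j)"
      using D elim B by (intro frac_le order_trans[OF _ D]) auto
    finally show ?case by simp
  qed
  have "(\<lambda>j. ereal (x j / C)) \<longlonglongrightarrow> ereal ((p + 1) / (3 * sqrt (2 * pi)) / C)"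
    using C by (intro tendsto_ereal tendsto_intros lim) simp
  hence "ereal ((p + 1) / (3 * sqrt (2 * pi)) / C) = limsup (\<lambda>j. ereal (x j / C))"
    by (rule lim_imp_Limsup[OF trivial_limit_sequentially, symmetric])
  also have "\<dots> \<le> limsup ((\<lambda>n. ereal (Delta (two_point p) n / L n)) \<circ> r)"
    using ev by (intro Limsup_mono) (simp add: o_def)
  also have "\<dots> \<le> limsup (\<lambda>n. ereal (Delta (two_point p) n / L n))"
    by (rule limsup_subseq_mono[OF r])
  finally show ?thesis .
qed

subsection \<open>Lyapunov-type fractions of two-point distributions\<close>

lemma mu1_two_point:
  assumes p: "0 < p" "p < 1"
  shows "mu1 (two_point p) y = p * (1 - p) * ((1 - p)\<^sup>2 * of_bool (1 - p < y) - p\<^sup>2 * of_bool (p < y))"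
  using p by (simp add: mu1_def integral_two_point indicator_def of_bool_def power2_eq_square power3_eq_cube algebra_simps)

lemma sigma1sq_tail_two_point:
  assumes p: "0 < p" "p < 1"
  shows "sigma1sq_tail (two_point p) y = p * (1 - p) * ((1 - p) * of_bool (y \<le> 1 - p) + p * of_bool (y \<le> p))"
  using p by (simp add: sigma1sq_tail_def integral_two_point indicator_def of_bool_def power2_eq_square algebra_simps)

lemma Bn_two_point_pos: "0 < p \<Longrightarrow> p < 1 \<Longrightarrow> 0 < n \<Longrightarrow> Bn (two_point p) n > 0"
  by (simp add: Bn_two_point)

lemma Mn_Ln_eq:
  assumes "n > 0" and s: "sigma1sq F > 0"
  shows "Mn F n z = mu1 F (z * Bn F n) / (sigma1sq F * Bn F n)"
    and "Ln F n z = sigma1sq_tail F (z * Bn F n) / sigma1sq F"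
proof -
  define B where "B = Bn F n"
  have B: "B > 0" "B\<^sup>2 = n * sigma1sq F" using assms by (auto simp: B_def Bn_def)
  have "B powr (-3) = 1 / (B\<^sup>2 * B)" "B powr (-2) = 1 / B\<^sup>2"
    using B(1) by (simp_all add: powr_minus_divide powr_numeral power3_eq_cube power2_eq_square)
  thus "Mn F n z = mu1 F (z * Bn F n) / (sigma1sq F * Bn F n)"
    and "Ln F n z = sigma1sq_tail F (z * Bn F n) / sigma1sq F"
    using assms unfolding Mn_def Ln_def B_def[symmetric] B(2) by simp_all
qed

lemma Mn_two_point:
  assumes p: "0 < p" "p < 1" and n: "n > 0"
  defines "B \<equiv> Bn (two_point p) n"
  shows "Mn (two_point p) n z = ((1 - p)\<^sup>2 * of_bool (1 - p < z * B) - p\<^sup>2 * of_bool (p < z * B)) / B"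
    and "Ln (two_point p) n z = (1 - p) * of_bool (z * B \<le> 1 - p) + p * of_bool (z * B \<le> p)"
  using p n by (simp_all add: Mn_Ln_eq sigma1sq_two_point mu1_two_point sigma1sq_tail_two_point B_def)

text \<open>The truncation level \<open>y = z * B_n\<close> lies below both atoms in absolute value,
  between them, or above both. In the three cases the expression is at most the first, second and
  third entry of the maximum, with \<open>y\<close> replaced by the right end of its range where it
  occurs.\<close>

lemma two_point_truncation_bound:
  fixes p \<gamma> y :: real
  assumes p: "1 / 2 \<le> p" "p < 1" and \<gamma>: "\<gamma> > 0" and y: "y > 0"
  shows "\<gamma> * \<bar>(1 - p)\<^sup>2 * of_bool (1 - p < y) - p\<^sup>2 * of_bool (p < y)\<bar>
      + y * ((1 - p) * of_bool (y \<le> 1 - p) + p * of_bool (y \<le> p))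
    \<le> Max {1 - p, \<gamma> * (1 - p)\<^sup>2 + p\<^sup>2, \<gamma> * (2 * p - 1)}"
proof -
  consider "y \<le> 1 - p" | "1 - p < y" "y \<le> p" | "p < y" by linarith
  thus ?thesis
  proof cases
    case 1
    thus ?thesis using p y by (simp add: algebra_simps)
  next
    case 2
    hence "y * p \<le> p\<^sup>2" using p unfolding power2_eq_square by (intro mult_right_mono) auto
    thus ?thesis using 2 p by (simp add: le_max_iff_disj)
  next
    case 3
    have "(1 - p)\<^sup>2 - p\<^sup>2 = - (2 * p - 1)" by (simp add: power2_eq_square algebra_simps)
    hence "\<bar>(1 - p)\<^sup>2 - p\<^sup>2\<bar> = 2 * p - 1" using p by simp
    thus ?thesis using 3 p by simp
  qed
qed

text \<open>The same three ranges of \<open>y\<close> without the third moment; they give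
  \<open>1 - p\<close>, \<open>p^2\<close> and 0.\<close>

lemma two_point_tail_bound:
  fixes p y :: real
  assumes p: "1 / 2 \<le> p" "p < 1" and y: "y > 0"
  shows "y * ((1 - p) * of_bool (y \<le> 1 - p) + p * of_bool (y \<le> p)) \<le> max (1 - p) (p\<^sup>2)"
proof -
  consider "y \<le> 1 - p" | "1 - p < y" "y \<le> p" | "p < y" by linarith
  thus ?thesis
  proof cases
    case 1
    thus ?thesis using p y by (simp add: algebra_simps)
  next
    case 2
    hence "y * p \<le> p\<^sup>2" using p unfolding power2_eq_square by (intro mult_right_mono) auto
    thus ?thesis using 2 p by (simp add: le_max_iff_disj)
  next
    case 3
    thus ?thesis using p by (simp add: le_max_iff_disj)
  qed
qed

lemma min_ratio:
  fixes z B :: real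
  assumes "B > 0" "z > 0"
  shows "min (z * B) B = min z 1 * B" and "min (z * B) B / (z * B) = 1 / max z 1"
  using assms by (auto simp: min_def max_def field_simps)

text \<open>The weight \<open>g0 (z B) / (z g0 B)\<close> equals \<open>1 / max z 1 \<le> 1\<close>,
  so the bound holds for every \<open>z > 0\<close> and \<open>C\<close> does not depend on
  \<open>e\<close>. This is what permits the infimum over \<open>e\<close>.\<close>

lemma L_E_two_point:
  assumes p: "1 / 2 \<le> p" "p < 1" and \<gamma>: "\<gamma> > 0" and e: "e > 0" and n: "n > 0"
  defines "C \<equiv> Max {1 - p, \<gamma> * (1 - p)\<^sup>2 + p\<^sup>2, \<gamma> * (2 * p - 1)}"
  shows "0 < L_E (two_point p) (g0 (two_point p)) e \<gamma> n"
    and "L_E (two_point p) (g0 (two_point p)) e \<gamma> n \<le> C / Bn (two_point p) n"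
proof -
  define B where "B = Bn (two_point p) n"
  have B: "B > 0" using p n by (simp add: B_def Bn_two_point_pos)
  define T where "T z = 1 / max z 1 * (\<gamma> * \<bar>Mn (two_point p) n z\<bar> + z * Ln (two_point p) n z)" for z
  have L: "L_E (two_point p) (g0 (two_point p)) e \<gamma> n = (SUP z\<in>{0<..<e}. T z)"
    unfolding L_E_def g0_def B_def[symmetric] T_def
    by (intro SUP_cong refl) (use B in \<open>auto simp: min_ratio min_def max_def\<close>)
  have T_eq: "T z = 1 / max z 1 * ((\<gamma> * \<bar>(1 - p)\<^sup>2 * of_bool (1 - p < z * B) - p\<^sup>2 * of_bool (p < z * B)\<bar>
      + z * B * ((1 - p) * of_bool (z * B \<le> 1 - p) + p * of_bool (z * B \<le> p))) / B)" for z
    using p n B by (simp add: T_def Mn_two_point add_divide_distrib abs_divide flip: B_def)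
  have le: "T z \<le> C / B" if "z > 0" for z
  proof -
    have "T z \<le> 1 * ((\<gamma> * \<bar>(1 - p)\<^sup>2 * of_bool (1 - p < z * B) - p\<^sup>2 * of_bool (p < z * B)\<bar>
      + z * B * ((1 - p) * of_bool (z * B \<le> 1 - p) + p * of_bool (z * B \<le> p))) / B)"
      unfolding T_eq using p \<gamma> B that
      by (intro mult_right_mono divide_nonneg_pos add_nonneg_nonneg mult_nonneg_nonneg) auto
    also have "\<dots> \<le> C / B"
      unfolding C_def mult_1_left using B that two_point_truncation_bound[OF p \<gamma>, of "z * B"]
      by (intro divide_right_mono) auto
    finally show ?thesis .
  qed
  show "L_E (two_point p) (g0 (two_point p)) e \<gamma> n \<le> C / Bn (two_point p) n"
    unfolding L B_def[symmetric] using e le by (intro cSUP_least) auto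
  \<comment> \<open>A level below both atoms, where the truncated tail is the whole variance; it
    makes the supremum positive.\<close>
  define z where "z = min (e / 2) ((1 - p) / B)"
  have z: "0 < z" "z < e" "z * B \<le> 1 - p"
    using e p B by (auto simp: z_def min_def field_simps)
  have "0 < T z"
    unfolding T_eq using z p \<gamma> B by (intro mult_pos_pos divide_pos_pos add_nonneg_pos) (auto simp: add_pos_pos)
  also have "T z \<le> (SUP z\<in>{0<..<e}. T z)"
    using z le by (intro cSUP_upper bdd_aboveI2[where M = "C / B"]) auto
  finally show "0 < L_E (two_point p) (g0 (two_point p)) e \<gamma> n" by (simp only: L)
qed

text \<open>The two parts of \<open>L_R\<close> are bounded separately, so their bounds add. The
  hypothesis \<open>large\<close> puts both atoms inside the truncation in \<open>Mn\<close> at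
  \<open>e\<close>; since \<open>B_n\<close> tends to infinity, it holds eventually.\<close>

lemma L_R_two_point:
  assumes p: "1 / 2 \<le> p" "p < 1" and \<gamma>: "\<gamma> > 0" and e: "e > 0" and n: "n > 0"
    and large: "p < e * Bn (two_point p) n"
  defines "C \<equiv> \<gamma> / max e 1 * (2 * p - 1) + max (1 - p) (p\<^sup>2)"
  shows "0 < L_R (two_point p) (g0 (two_point p)) e \<gamma> n"
    and "L_R (two_point p) (g0 (two_point p)) e \<gamma> n \<le> C / Bn (two_point p) n"
proof -
  define B where "B = Bn (two_point p) n"
  have B: "B > 0" using p n by (simp add: B_def Bn_two_point_pos)
  define T where "T z = min z 1 * Ln (two_point p) n z" for z
  have "Mn (two_point p) n e = ((1 - p)\<^sup>2 - p\<^sup>2) / B"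
    using p n large by (simp add: Mn_two_point flip: B_def)
  also have "(1 - p)\<^sup>2 - p\<^sup>2 = - (2 * p - 1)" by (simp add: power2_eq_square algebra_simps)
  finally have M: "\<bar>Mn (two_point p) n e\<bar> = (2 * p - 1) / B"
    using p B by (simp add: abs_divide)
  have "\<gamma> * g0 (two_point p) n (e * B) / (e * g0 (two_point p) n B) = \<gamma> / max e 1"
  proof -
    have "\<gamma> * g0 (two_point p) n (e * B) / (e * g0 (two_point p) n B) = \<gamma> * (min (e * B) B / (e * B))"
      by (simp add: g0_def flip: B_def)
    also have "\<dots> = \<gamma> / max e 1" unfolding min_ratio(2)[OF B e] by simp
    finally show ?thesis .
  qed
  hence L: "L_R (two_point p) (g0 (two_point p)) e \<gamma> n = \<gamma> / max e 1 * ((2 * p - 1) / B) + (SUP z\<in>{0<..<e}. T z)"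
    unfolding L_R_def B_def[symmetric] M T_def
    by (simp, intro SUP_cong refl) (use B in \<open>simp add: min_ratio g0_def flip: B_def\<close>)
  have T_eq: "T z = min z 1 * ((1 - p) * of_bool (z * B \<le> 1 - p) + p * of_bool (z * B \<le> p))" for z
    using p n by (simp add: T_def Mn_two_point flip: B_def)
  have le: "T z \<le> max (1 - p) (p\<^sup>2) / B" if "z > 0" for z
  proof -
    have "T z \<le> z * ((1 - p) * of_bool (z * B \<le> 1 - p) + p * of_bool (z * B \<le> p))"
      unfolding T_eq using p by (intro mult_right_mono) auto
    also have "\<dots> = z * B * ((1 - p) * of_bool (z * B \<le> 1 - p) + p * of_bool (z * B \<le> p)) / B"
      using B by simp
    also have "\<dots> \<le> max (1 - p) (p\<^sup>2) / B"
      using B that two_point_tail_bound[OF p, of "z * B"] by (intro divide_right_mono) auto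
    finally show ?thesis .
  qed
  have "(SUP z\<in>{0<..<e}. T z) \<le> max (1 - p) (p\<^sup>2) / B"
    using e le by (intro cSUP_least) auto
  thus "L_R (two_point p) (g0 (two_point p)) e \<gamma> n \<le> C / Bn (two_point p) n"
    unfolding L C_def B_def[symmetric] by (simp add: add_divide_distrib)
  define z where "z = min (e / 2) ((1 - p) / B)"
  have z: "0 < z" "z < e" "z * B \<le> 1 - p"
    using e p B by (auto simp: z_def min_def field_simps)
  have "0 < T z"
    unfolding T_eq using z p by (intro mult_pos_pos add_pos_nonneg) auto
  also have "T z \<le> (SUP z\<in>{0<..<e}. T z)"
    using z le by (intro cSUP_upper bdd_aboveI2[where M = "max (1 - p) (p\<^sup>2) / B"]) auto
  finally have "0 < (SUP z\<in>{0<..<e}. T z)" .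
  moreover have "\<gamma> / max e 1 * ((2 * p - 1) / B) \<ge> 0" using p \<gamma> B by simp
  ultimately show "0 < L_R (two_point p) (g0 (two_point p)) e \<gamma> n" unfolding L by linarith
qed

section \<open>Lower bounds for the constants with \<open>g0\<close>\<close>

lemma ereal_le_of_rational:
  fixes h :: "real \<Rightarrow> real" and X :: ereal
  assumes cont: "isCont h p" and p: "a < p" "p < b"
    and le: "\<And>x. x \<in> \<rat> \<Longrightarrow> a < x \<Longrightarrow> x < b \<Longrightarrow> ereal (h x) \<le> X"
  shows "ereal (h p) \<le> X"
proof (rule ccontr)
  assume "\<not> ?thesis"
  hence "X < ereal (h p)" by simp
  moreover have "((\<lambda>x. ereal (h x)) \<longlongrightarrow> ereal (h p)) (at_right p)"
    using cont by (intro tendsto_ereal) (auto simp: isCont_def filterlim_at_split)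
  ultimately have "eventually (\<lambda>x. X < ereal (h x)) (at_right p)"
    by (rule order_tendstoD(1)[rotated])
  then obtain c where c: "c > p" "\<And>x. p < x \<Longrightarrow> x < c \<Longrightarrow> X < ereal (h x)"
    using p by (auto simp: eventually_at_right[of p b])
  obtain x where "x \<in> \<rat>" "p < x" "x < min b c"
    using Rats_dense_in_real[of p "min b c"] c p by auto
  with c(2)[of x] le[of x] p show False by auto
qed

lemma C_AB_E_g0_ge:
  assumes p: "1 / 2 < p" "p < 1" and \<gamma>: "\<gamma> > 0" and e: "e > 0"
  shows "ereal ((p + 1) / (3 * sqrt (2 * pi)) / Max {1 - p, \<gamma> * (1 - p)\<^sup>2 + p\<^sup>2, \<gamma> * (2 * p - 1)})
     \<le> C_AB_E g0 e \<gamma>"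
proof (rule ereal_le_of_rational[OF _ p])
  have pos: "Max {1 - p, \<gamma> * (1 - p)\<^sup>2 + p\<^sup>2, \<gamma> * (2 * p - 1)} > 0" if "p < 1" for p
    using that by (simp add: less_max_iff_disj)
  show "isCont (\<lambda>p. (p + 1) / (3 * sqrt (2 * pi)) / Max {1 - p, \<gamma> * (1 - p)\<^sup>2 + p\<^sup>2, \<gamma> * (2 * p - 1)}) p"
    using pos[of p] p by (auto intro!: continuous_intros)
  fix x :: real assume x: "x \<in> \<rat>" "1 / 2 < x" "x < 1"
  have "ereal ((x + 1) / (3 * sqrt (2 * pi)) / Max {1 - x, \<gamma> * (1 - x)\<^sup>2 + x\<^sup>2, \<gamma> * (2 * x - 1)})
      \<le> limsup (\<lambda>n. ereal (Delta (two_point x) n / L_E (two_point x) (g0 (two_point x)) e \<gamma> n))"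
    using x \<gamma> e pos[of x] L_E_two_point[of x \<gamma> e]
    by (intro limsup_two_point_ge eventually_mono[OF eventually_gt_at_top[of 0]]) auto
  also have "\<dots> \<le> C_AB_E g0 e \<gamma>"
    unfolding C_AB_E_def using x by (intro SUP_upper two_point_in_distF) auto
  finally show "ereal ((x + 1) / (3 * sqrt (2 * pi)) / Max {1 - x, \<gamma> * (1 - x)\<^sup>2 + x\<^sup>2, \<gamma> * (2 * x - 1)})
      \<le> C_AB_E g0 e \<gamma>" .
qed

text \<open>Kept apart from \<open>C_AB_R_g0_ge\<close> because it admits the endpoint
  \<open>p = 1/2\<close>, which yields the second branch of the bound.\<close>

lemma C_AB_R_g0_ge_rational:
  assumes p: "1 / 2 \<le> p" "p < 1" "p \<in> \<rat>" and \<gamma>: "\<gamma> > 0" and e: "e > 0"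
  shows "ereal ((p + 1) / (3 * sqrt (2 * pi)) / (\<gamma> / max e 1 * (2 * p - 1) + max (1 - p) (p\<^sup>2)))
     \<le> C_AB_R g0 e \<gamma>"
proof -
  have pos: "\<gamma> / max e 1 * (2 * p - 1) + max (1 - p) (p\<^sup>2) > 0"
    using p \<gamma> by (intro add_nonneg_pos) (auto simp: less_max_iff_disj)
  have "filterlim (\<lambda>n. c * sqrt (real n)) at_top sequentially" if "c > 0" for c :: real
    using that by real_asymp
  from this[of "e * sqrt (p * (1 - p))"]
  have "filterlim (\<lambda>n. e * sqrt (p * (1 - p)) * sqrt (real n)) at_top sequentially"
    using p e by simp
  hence "eventually (\<lambda>n. p < e * Bn (two_point p) n) sequentially"
    using p by (simp add: filterlim_at_top_dense Bn_two_point mult.assoc)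
  hence "eventually (\<lambda>n. 0 < L_R (two_point p) (g0 (two_point p)) e \<gamma> n \<and>
      L_R (two_point p) (g0 (two_point p)) e \<gamma> n
        \<le> (\<gamma> / max e 1 * (2 * p - 1) + max (1 - p) (p\<^sup>2)) / Bn (two_point p) n) sequentially"
    using eventually_gt_at_top[of 0] by eventually_elim (use p \<gamma> e L_R_two_point[of p \<gamma> e] in auto)
  hence "ereal ((p + 1) / (3 * sqrt (2 * pi)) / (\<gamma> / max e 1 * (2 * p - 1) + max (1 - p) (p\<^sup>2)))
      \<le> limsup (\<lambda>n. ereal (Delta (two_point p) n / L_R (two_point p) (g0 (two_point p)) e \<gamma> n))"
    using p by (intro limsup_two_point_ge pos) auto
  also have "\<dots> \<le> C_AB_R g0 e \<gamma>"
    unfolding C_AB_R_def using p by (intro SUP_upper two_point_in_distF) auto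
  finally show ?thesis .
qed

lemma C_AB_R_g0_ge:
  assumes p: "1 / 2 < p" "p < 1" and \<gamma>: "\<gamma> > 0" and e: "e > 0"
  shows "ereal ((p + 1) / (3 * sqrt (2 * pi)) / (\<gamma> / max e 1 * (2 * p - 1) + max (1 - p) (p\<^sup>2)))
     \<le> C_AB_R g0 e \<gamma>"
proof (rule ereal_le_of_rational[OF _ p])
  define t where "t = \<gamma> / max e 1"
  have "t \<ge> 0" using \<gamma> by (simp add: t_def)
  hence "t * (2 * p - 1) + max (1 - p) (p\<^sup>2) > 0"
    using p by (intro add_nonneg_pos) (auto simp: less_max_iff_disj)
  thus "isCont (\<lambda>p. (p + 1) / (3 * sqrt (2 * pi)) / (\<gamma> / max e 1 * (2 * p - 1) + max (1 - p) (p\<^sup>2))) p"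
    unfolding t_def[symmetric] by (intro continuous_intros) auto
qed (use C_AB_R_g0_ge_rational \<gamma> e in auto)

subsection \<open>Uniform central limit theorem\<close>

lemma sigma1sq_pos:
  assumes "F \<in> distF"
  shows "sigma1sq F > 0"
proof (rule ccontr)
  interpret prob_space F using assms by (simp add: distF_def)
  have sets: "sets F = sets borel" and int: "integrable F (\<lambda>x. x\<^sup>2)" and nd: "\<nexists>c. F = return borel c"
    using assms by (auto simp: distF_def)
  assume "\<not> sigma1sq F > 0"
  moreover have "sigma1sq F \<ge> 0" by (simp add: sigma1sq_def)
  ultimately have "(\<integral>x. x\<^sup>2 \<partial>F) = 0" unfolding sigma1sq_def by linarith
  hence "AE x in F. x\<^sup>2 = 0"
    by (subst (asm) integral_nonneg_eq_0_iff_AE[OF int]) auto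
  hence ae: "AE x in F. x = 0" by simp
  have "F = return borel 0"
  proof (rule measure_eqI)
    fix A assume A: "A \<in> sets F"
    have "emeasure F A = (\<integral>\<^sup>+x. indicator A x \<partial>F)" using A by simp
    also have "\<dots> = (\<integral>\<^sup>+x. indicator A (0::real) \<partial>F)"
      by (rule nn_integral_cong_AE) (use ae in auto)
    also have "\<dots> = indicator A 0" by (simp add: emeasure_space_1)
    finally show "emeasure F A = emeasure (return borel 0) A" using A sets by simp
  qed (simp add: sets)
  thus False using nd by blast
qed

text \<open>\<open>iidM\<close> is a different finite product for each \<open>n\<close>, while the
  central limit theorem wants one space carrying the whole sequence. The infinite product serves as
  that space, and restriction to the first \<open>n\<close> coordinates leads back.\<close>

lemma cdf_sum_tendsto:
  assumes F: "F \<in> distF"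
  shows "(\<lambda>n. measure (iidM F n) {\<omega> \<in> space (iidM F n). (\<Sum>i<n. \<omega> i) / Bn F n \<le> x}) \<longlonglongrightarrow> Phi x"
proof -
  have sets [measurable_cong]: "sets F = sets borel"
    and int: "integrable F (\<lambda>x. x\<^sup>2)" and mean: "(\<integral>x. x \<partial>F) = 0" and ps: "prob_space F"
    using F by (auto simp: distF_def)
  interpret product_prob_space "\<lambda>_. F" "UNIV :: nat set"
    by (rule product_prob_spaceI) (rule ps)
  let ?M = "PiM UNIV (\<lambda>_. F) :: (nat \<Rightarrow> real) measure"
  define \<sigma> where "\<sigma> = sqrt (sigma1sq F)"
  have \<sigma>: "\<sigma> > 0" "\<sigma>\<^sup>2 = sigma1sq F" using sigma1sq_pos[OF F] by (auto simp: \<sigma>_def)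
  have comp: "distr ?M borel (\<lambda>\<omega>. \<omega> i) = F" for i
  proof -
    have "distr ?M borel (\<lambda>\<omega>. \<omega> i) = distr ?M F (\<lambda>\<omega>. \<omega> i)" by (intro distr_cong sets[symmetric]) auto
    also have "\<dots> = F" by (rule distr_PiM_component) (auto simp: ps)
    finally show ?thesis .
  qed
  have meas: "(\<lambda>\<omega>. \<omega> i) \<in> borel_measurable ?M" for i by measurable
  have indep: "P.indep_vars (\<lambda>_. borel) (\<lambda>i \<omega>. \<omega> i) UNIV"
  proof (subst P.indep_vars_iff_distr_eq_PiM)
    show "distr ?M (PiM UNIV (\<lambda>_. borel)) (\<lambda>x. \<lambda>i\<in>UNIV. x i) = PiM UNIV (\<lambda>i. distr ?M borel (\<lambda>\<omega>. \<omega> i))"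
    proof -
      have "distr ?M (PiM UNIV (\<lambda>_. borel)) (\<lambda>x. x) = distr ?M ?M (\<lambda>x. x)"
        by (intro distr_cong sets_PiM_cong sets[symmetric] refl)
      thus ?thesis unfolding comp restrict_UNIV distr_id .
    qed
  qed (auto simp: meas)
  have tr: "(\<integral>\<omega>. f (\<omega> i) \<partial>?M) = (\<integral>x. f x \<partial>F)" if "f \<in> borel_measurable borel" for f :: "real \<Rightarrow> real" and i
    using integral_distr[OF meas that, of i] by (simp add: comp)
  have "weak_conv_m (\<lambda>n. distr ?M borel (\<lambda>\<omega>. (\<Sum>i<n. \<omega> i) / sqrt (n * \<sigma>\<^sup>2))) std_normal_distribution"
  proof (rule P.central_limit_theorem_zero_mean[OF indep _ \<sigma>(1) _ _ comp])
    show E: "P.expectation (\<lambda>\<omega>. \<omega> n) = 0" for n using tr[of "\<lambda>x. x" n] mean by simp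
    show "integrable ?M (\<lambda>\<omega>. (\<omega> n)\<^sup>2)" for n
      using int comp[of n] integrable_distr_eq[OF meas, of "\<lambda>x. x\<^sup>2" n] by simp
    show "P.variance (\<lambda>\<omega>. \<omega> n) = \<sigma>\<^sup>2" for n
      using tr[of "\<lambda>x. x\<^sup>2" n] by (simp add: E \<sigma>(2) sigma1sq_def)
  qed
  hence "(\<lambda>n. cdf (distr ?M borel (\<lambda>\<omega>. (\<Sum>i<n. \<omega> i) / Bn F n)) x) \<longlonglongrightarrow> Phi x"
    using isCont_Phi[of x] unfolding weak_conv_m_def weak_conv_def
    by (simp add: Phi_eq_cdf[abs_def] \<sigma>(2) Bn_def)
  moreover have "cdf (distr ?M borel (\<lambda>\<omega>. (\<Sum>i<n. \<omega> i) / Bn F n)) x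
     = measure (iidM F n) {\<omega> \<in> space (iidM F n). (\<Sum>i<n. \<omega> i) / Bn F n \<le> x}" for n
  proof -
    have "iidM F n = distr ?M (PiM {..<n} (\<lambda>_. F)) (\<lambda>\<omega>. restrict \<omega> {..<n})"
      unfolding iidM_def by (rule distr_PiM_restrict_finite[symmetric]) auto
    hence "measure (iidM F n) {\<omega> \<in> space (iidM F n). (\<Sum>i<n. \<omega> i) / Bn F n \<le> x}
       = measure ?M ((\<lambda>\<omega>. restrict \<omega> {..<n}) -` {\<omega> \<in> space (PiM {..<n} (\<lambda>_. F)). (\<Sum>i<n. \<omega> i) / Bn F n \<le> x} \<inter> space ?M)"
      by (simp add: measure_distr measurable_restrict_subset)
    also have "(\<lambda>\<omega>. restrict \<omega> {..<n}) -` {\<omega> \<in> space (PiM {..<n} (\<lambda>_. F)). (\<Sum>i<n. \<omega> i) / Bn F n \<le> x} \<inter> space ?M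
       = {\<omega> \<in> space ?M. (\<Sum>i<n. \<omega> i) / Bn F n \<le> x}"
      by (auto simp: space_PiM)
    finally show ?thesis
      by (simp add: cdf_def2 measure_distr vimage_def Int_def conj_commute)
  qed
  ultimately show ?thesis by simp
qed

text \<open>Uniform continuity on a compact interval outside of which \<open>Phi\<close> is within
  \<delta> of 0 or 1. Each cell is open on the left and closed on the right: then P(S \<le> a) \<le>
  P(S < x) \<le> P(S \<le> b), so convergence of the weak-inequality distribution functions controls
  the strict one in \<open>Delta\<close>.\<close>

lemma Phi_grid:
  assumes "\<delta> > 0"
  obtains T where "finite T"
    "\<And>x. (\<exists>b\<in>T. x \<le> b \<and> Phi b < \<delta>) \<or> (\<exists>a\<in>T. a < x \<and> Phi a > 1 - \<delta>) \<or>
         (\<exists>a\<in>T. \<exists>b\<in>T. a < x \<and> x \<le> b \<and> Phi b < Phi a + \<delta>)"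
proof -
  have top: "(Phi \<longlongrightarrow> 1) at_top" using std_normal.cdf_lim_at_top_prob by (simp add: Phi_eq_cdf[abs_def])
  have bot: "(Phi \<longlongrightarrow> 0) at_bot" using std_normal.cdf_lim_at_bot by (simp add: Phi_eq_cdf[abs_def])
  obtain B where B: "Phi B > 1 - \<delta>"
    using eventually_happens[OF order_tendstoD(1)[OF top, of "1 - \<delta>"]] assms by auto
  obtain A where A: "Phi A < \<delta>" "A < B"
    using eventually_happens[OF eventually_conj[OF order_tendstoD(2)[OF bot assms] eventually_gt_at_bot[of B]]]
    by (auto simp: eventually_at_bot_dense)
  have "uniformly_continuous_on {A..B} Phi"
    by (intro compact_uniformly_continuous continuous_at_imp_continuous_on ballI isCont_Phi) auto
  then obtain d where d: "d > 0" "\<And>x y. x \<in> {A..B} \<Longrightarrow> y \<in> {A..B} \<Longrightarrow> dist y x < d \<Longrightarrow> dist (Phi y) (Phi x) < \<delta>"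
    using assms unfolding uniformly_continuous_on_def by metis
  obtain m :: nat where m: "(B - A) / d < m" using reals_Archimedean2 by blast
  have m0: "m > 0" using m A(2) d(1) by (metis divide_pos_pos diff_gt_0_iff_gt of_nat_0_less_iff less_trans)
  define t where "t k = A + real k * ((B - A) / m)" for k :: nat
  have step: "(B - A) / m < d" using m m0 d(1) by (simp add: field_simps)
  have t0: "t 0 = A" "t m = B" using m0 by (auto simp: t_def)
  have tmono: "t i \<le> t j" if "i \<le> j" for i j
    using that A(2) by (simp add: t_def divide_right_mono mult_right_mono)
  show ?thesis
  proof (rule that)
    show "finite (t ` {..m})" by simp
    fix x :: real
    consider "x \<le> A" | "B < x" | "A < x" "x \<le> B" by linarith
    thus "(\<exists>b\<in>t ` {..m}. x \<le> b \<and> Phi b < \<delta>) \<or> (\<exists>a\<in>t ` {..m}. a < x \<and> Phi a > 1 - \<delta>) \<or>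
         (\<exists>a\<in>t ` {..m}. \<exists>b\<in>t ` {..m}. a < x \<and> x \<le> b \<and> Phi b < Phi a + \<delta>)"
    proof cases
      case 1
      hence "x \<le> t 0 \<and> Phi (t 0) < \<delta>" using A by (simp add: t0)
      thus ?thesis by blast
    next
      case 2
      hence "t m < x \<and> Phi (t m) > 1 - \<delta>" using B by (simp add: t0)
      thus ?thesis by blast
    next
      case 3
      \<comment> \<open>The first grid point not below \<open>x\<close>; its predecessor is the left
        end of the cell.\<close>
      define k where "k = (LEAST k. x \<le> t k)"
      have "x \<le> t m" using 3 by (simp add: t0)
      hence k: "x \<le> t k" "k \<le> m" unfolding k_def by (rule LeastI, rule Least_le)
      have "k \<noteq> 0" using k(1) 3 t0 by (metis not_le)
      then obtain j where j: "k = Suc j" by (cases k) auto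
      have xj: "t j < x" using not_less_Least[of j "\<lambda>k. x \<le> t k"] j by (auto simp: k_def)
      have "dist (t k) (t j) < d"
        using step A(2) by (simp add: j t_def dist_real_def algebra_simps flip: add_divide_distrib diff_divide_distrib)
      moreover have "t j \<in> {A..B}" "t k \<in> {A..B}"
        using tmono[of 0 j] tmono[of j m] tmono[of 0 k] tmono[of k m] j k(2) by (auto simp: t0)
      ultimately have "dist (Phi (t k)) (Phi (t j)) < \<delta>" by (intro d(2))
      hence "Phi (t k) < Phi (t j) + \<delta>" by (simp add: dist_real_def)
      moreover have "t j \<in> t ` {..m}" "t k \<in> t ` {..m}" using j k(2) by auto
      ultimately show ?thesis using xj k(1) by blast
    qed
  qed
qed

lemma Delta_tendsto_0:
  assumes F: "F \<in> distF"
  shows "Delta F \<longlonglongrightarrow> 0"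
proof (rule LIMSEQ_I)
  fix r :: real assume r: "r > 0"
  \<comment> \<open>One \<delta> pays for convergence at the grid points and one for the oscillation
    of \<open>Phi\<close> in a cell or a tail; the third makes the final inequality strict.\<close>
  define \<delta> where "\<delta> = r / 3"
  have \<delta>: "\<delta> > 0" using r by (simp add: \<delta>_def)
  have sets [measurable_cong]: "sets F = sets borel" and ps: "prob_space F" using F by (auto simp: distF_def)
  define G where "G n x = measure (iidM F n) {\<omega> \<in> space (iidM F n). (\<Sum>i<n. \<omega> i) / Bn F n \<le> x}" for n x
  define G' where "G' n x = measure (iidM F n) {\<omega> \<in> space (iidM F n). (\<Sum>i<n. \<omega> i) / Bn F n < x}" for n x
  have P: "prob_space (iidM F n)" for n unfolding iidM_def by (intro prob_space_PiM ps)
  have M: "(\<lambda>\<omega>. (\<Sum>i<n. \<omega> i) / Bn F n) \<in> borel_measurable (iidM F n)" for n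
    unfolding iidM_def by measurable
  have GG: "G' n x \<le> G n b" if "x \<le> b" for n x b
    unfolding G_def G'_def
    by (rule finite_measure.finite_measure_mono[OF prob_space.finite_measure[OF P]]) (use that M[of n] in \<open>auto, measurable\<close>)
  have GG': "G n a \<le> G' n x" if "a < x" for n x a
    unfolding G_def G'_def
    by (rule finite_measure.finite_measure_mono[OF prob_space.finite_measure[OF P]]) (use that M[of n] in \<open>auto, measurable\<close>)
  have G01: "0 \<le> G' n x" "G' n x \<le> 1" for n x
    unfolding G'_def by (auto intro: prob_space.prob_le_1[OF P])
  have Phi01: "0 \<le> Phi x" "Phi x \<le> 1" for x by (auto simp: Phi_def std_normal.prob_le_1)
  obtain T where T: "finite T" "\<And>x. (\<exists>b\<in>T. x \<le> b \<and> Phi b < \<delta>) \<or> (\<exists>a\<in>T. a < x \<and> Phi a > 1 - \<delta>) \<or>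
         (\<exists>a\<in>T. \<exists>b\<in>T. a < x \<and> x \<le> b \<and> Phi b < Phi a + \<delta>)"
    by (rule Phi_grid[OF \<delta>]) (rule that)
  have "eventually (\<lambda>n. \<forall>a\<in>T. \<bar>G n a - Phi a\<bar> < \<delta>) sequentially"
    using T(1)
  proof (rule eventually_ball_finite, intro ballI)
    fix a
    show "eventually (\<lambda>n. \<bar>G n a - Phi a\<bar> < \<delta>) sequentially"
      using tendstoD[OF cdf_sum_tendsto[OF F, of a] \<delta>] by (simp add: G_def dist_real_def)
  qed
  then obtain n0 where n0: "\<And>n a. n \<ge> n0 \<Longrightarrow> a \<in> T \<Longrightarrow> \<bar>G n a - Phi a\<bar> < \<delta>"
    by (auto simp: eventually_sequentially)
  have "\<bar>Delta F n\<bar> < r" if n: "n \<ge> n0" for n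
  proof -
    have bd: "\<bar>G' n x - Phi x\<bar> \<le> 2 * \<delta>" for x
      using T(2)[of x]
    proof (elim disjE bexE conjE)
      fix b assume "b \<in> T" "x \<le> b" "Phi b < \<delta>"
      thus ?thesis using n0[OF n, of b] GG[of x b n] G01[of n x] Phi01[of x] Phi_mono[of x b] \<delta> by linarith
    next
      fix a assume "a \<in> T" "a < x" "1 - \<delta> < Phi a"
      thus ?thesis using n0[OF n, of a] GG'[of a x n] G01[of n x] Phi01[of x] Phi_mono[of a x] \<delta> by linarith
    next
      fix a b assume "a \<in> T" "b \<in> T" "a < x" "x \<le> b" "Phi b < Phi a + \<delta>"
      thus ?thesis using n0[OF n, of a] n0[OF n, of b] GG'[of a x n] GG[of x b n] Phi_mono[of a x] Phi_mono[of x b]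
        by linarith
    qed
    have "Delta F n \<le> 2 * \<delta>"
      unfolding Delta_def G'_def[symmetric] by (intro cSUP_least bd) simp
    moreover have "0 \<le> Delta F n"
    proof -
      have "0 \<le> \<bar>G' n 0 - Phi 0\<bar>" by simp
      also have "\<dots> \<le> Delta F n"
        unfolding Delta_def G'_def[symmetric] by (intro cSUP_upper bdd_aboveI2[OF bd]) simp
      finally show ?thesis .
    qed
    ultimately show ?thesis using r by (simp add: \<delta>_def)
  qed
  thus "\<exists>n0. \<forall>n\<ge>n0. norm (Delta F n - 0) < r" by auto
qed

subsection \<open>The fractions for \<open>g1\<close>\<close>

lemma truncated_moment_bounds:
  assumes F: "F \<in> distF" and y: "y > 0"
  shows "\<bar>mu1 F y\<bar> \<le> y * sigma1sq F" and "0 \<le> sigma1sq_tail F y" and "sigma1sq_tail F y \<le> sigma1sq F"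
proof -
  have sets [measurable_cong]: "sets F = sets borel" and int: "integrable F (\<lambda>x. x\<^sup>2)"
    using F by (auto simp: distF_def)
  have "norm (mu1 F y) \<le> (\<integral>x. y * x\<^sup>2 \<partial>F)"
    unfolding mu1_def
  proof (rule Bochner_Integration.integral_norm_bound_integral)
    have le: "norm (x ^ 3 * indicator {x. \<bar>x\<bar> < y} x) \<le> y * x\<^sup>2" for x :: real
    proof -
      have "\<bar>x\<bar> * x\<^sup>2 \<le> y * x\<^sup>2" if "\<bar>x\<bar> < y" using that by (intro mult_right_mono) auto
      thus ?thesis using y by (auto simp: indicator_def abs_mult power3_eq_cube power2_eq_square)
    qed
    thus "norm (x ^ 3 * indicator {x. \<bar>x\<bar> < y} x) \<le> y * x\<^sup>2" for x .
    show int': "integrable F (\<lambda>x. y * x\<^sup>2)" using int by simp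
    show "integrable F (\<lambda>x. x ^ 3 * indicator {x. \<bar>x\<bar> < y} x)"
      by (rule Bochner_Integration.integrable_bound[OF int']) (use le y in \<open>auto simp: abs_mult\<close>)
  qed
  thus "\<bar>mu1 F y\<bar> \<le> y * sigma1sq F" by (simp add: sigma1sq_def)
  show "0 \<le> sigma1sq_tail F y" by (simp add: sigma1sq_tail_def)
  show "sigma1sq_tail F y \<le> sigma1sq F"
    unfolding sigma1sq_tail_def sigma1sq_def
    by (intro integral_mono int integrable_real_mult_indicator) (auto simp: indicator_def)
qed

text \<open>As \<open>y\<close> tends to 0 only the point \<open>x = 0\<close> stays excluded, and
  it contributes nothing to the second moment. Monotonicity in \<open>y\<close> passes from the
  sequence \<open>1 / Suc n\<close> to all small \<open>y\<close>.\<close>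

lemma sigma1sq_tail_ge_half:
  assumes F: "F \<in> distF"
  shows "eventually (\<lambda>y. sigma1sq_tail F y \<ge> sigma1sq F / 2) (at_right 0)"
proof -
  have sets [measurable_cong]: "sets F = sets borel" and int: "integrable F (\<lambda>x. x\<^sup>2)"
    using F by (auto simp: distF_def)
  have pos: "sigma1sq F > 0" by (rule sigma1sq_pos[OF F])
  have "(\<lambda>n. sigma1sq_tail F (1 / real (Suc n))) \<longlonglongrightarrow> sigma1sq F"
    unfolding sigma1sq_tail_def sigma1sq_def
  proof (rule integral_dominated_convergence[OF _ _ int])
    show "AE x in F. (\<lambda>n. x\<^sup>2 * indicator {x. 1 / real (Suc n) \<le> \<bar>x\<bar>} x) \<longlonglongrightarrow> x\<^sup>2"
    proof (intro AE_I2)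
      fix x :: real
      show "(\<lambda>n. x\<^sup>2 * indicator {x. 1 / real (Suc n) \<le> \<bar>x\<bar>} x) \<longlonglongrightarrow> x\<^sup>2"
      proof (cases "x = 0")
        case False
        have "eventually (\<lambda>n. 1 / real (Suc n) < \<bar>x\<bar>) sequentially"
          using False by (intro order_tendstoD(2)[OF LIMSEQ_Suc[OF lim_1_over_n]]) simp
        hence "eventually (\<lambda>n. x\<^sup>2 = x\<^sup>2 * indicator {x. 1 / real (Suc n) \<le> \<bar>x\<bar>} x) sequentially"
          by eventually_elim simp
        thus ?thesis by (rule Lim_transform_eventually[OF tendsto_const])
      qed simp
    qed
    show "AE x in F. norm (x\<^sup>2 * indicator {x. 1 / real (Suc n) \<le> \<bar>x\<bar>} x) \<le> x\<^sup>2" for n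
      by (intro AE_I2) (auto simp: indicator_def)
  qed measurable
  hence "eventually (\<lambda>n. sigma1sq_tail F (1 / real (Suc n)) > sigma1sq F / 2) sequentially"
    by (rule order_tendstoD(1)) (use pos in simp)
  then obtain n where n: "sigma1sq_tail F (1 / real (Suc n)) > sigma1sq F / 2"
    by (auto simp: eventually_sequentially)
  have "sigma1sq_tail F y \<ge> sigma1sq F / 2" if "0 < y" "y < 1 / real (Suc n)" for y
  proof -
    have "sigma1sq_tail F (1 / real (Suc n)) \<le> sigma1sq_tail F y"
      unfolding sigma1sq_tail_def using that
      by (intro integral_mono int integrable_real_mult_indicator) (auto simp: indicator_def)
    thus ?thesis using n by simp
  qed
  thus ?thesis unfolding eventually_at_right_field by (intro exI[of _ "1 / real (Suc n)"]) auto
qed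

text \<open>Crude bounds whose purpose is to make the families under the suprema bounded above, so
  that a real supremum dominates each of its members.\<close>

lemma Mn_Ln_bounds:
  assumes F: "F \<in> distF" and n: "n > 0" and z: "z > 0"
  shows "\<bar>Mn F n z\<bar> \<le> z" "0 \<le> Ln F n z" "Ln F n z \<le> 1"
proof -
  have s: "sigma1sq F > 0" by (rule sigma1sq_pos[OF F])
  have B: "Bn F n > 0" using s n by (simp add: Bn_def)
  hence zB: "z * Bn F n > 0" using z by simp
  show "\<bar>Mn F n z\<bar> \<le> z" "0 \<le> Ln F n z" "Ln F n z \<le> 1"
    using truncated_moment_bounds[OF F zB] s B
    by (simp_all add: Mn_Ln_eq[OF n s] abs_divide abs_mult divide_le_eq mult_ac)
qed

lemma ex_Ln_ge_half:
  assumes F: "F \<in> distF" and n: "n > 0" and e: "e > 0"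
  obtains z where "0 < z" "z < e" "Ln F n z \<ge> 1 / 2"
proof -
  have s: "sigma1sq F > 0" by (rule sigma1sq_pos[OF F])
  have B: "Bn F n > 0" using s n by (simp add: Bn_def)
  obtain b where b: "b > 0" "\<And>y. 0 < y \<Longrightarrow> y < b \<Longrightarrow> sigma1sq_tail F y \<ge> sigma1sq F / 2"
    using sigma1sq_tail_ge_half[OF F] unfolding eventually_at_right_field by auto
  define z where "z = min (e / 2) (b / (2 * Bn F n))"
  have z: "0 < z" "z < e" "z * Bn F n < b"
    using e b B by (auto simp: z_def min_def field_simps)
  have "sigma1sq_tail F (z * Bn F n) \<ge> sigma1sq F / 2"
    using z B by (intro b) auto
  hence "Ln F n z \<ge> 1 / 2" using s by (simp add: Mn_Ln_eq[OF n s] field_simps)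
  with that z show ?thesis by blast
qed

lemma g1_ratio:
  assumes "Bn F n > 0"
  shows "g1 F n (z * Bn F n) = max z 1 * Bn F n" "g1 F n (Bn F n) = Bn F n"
  using assms by (auto simp: g1_def max_def)

text \<open>Here the weight is \<open>max z 1 / z \<ge> 1 / z\<close>, which cancels the factor
  \<open>z\<close> in front of \<open>Ln\<close>. Small \<open>z\<close> therefore keep their full
  contribution, whereas \<open>g0\<close> damps it by \<open>min z 1\<close>.\<close>

lemma L_E_g1_ge:
  assumes F: "F \<in> distF" and n: "n > 0" and e: "e > 0" and \<gamma>: "\<gamma> > 0"
  shows "L_E F (g1 F) e \<gamma> n \<ge> 1 / 2"
proof -
  have B: "Bn F n > 0" using sigma1sq_pos[OF F] n by (simp add: Bn_def)
  define T where "T z = max z 1 / z * (\<gamma> * \<bar>Mn F n z\<bar> + z * Ln F n z)" for z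
  have L: "L_E F (g1 F) e \<gamma> n = (SUP z\<in>{0<..<e}. T z)"
    unfolding L_E_def T_def by (intro SUP_cong refl) (use B in \<open>simp add: g1_ratio\<close>)
  have T_le: "T z \<le> max e 1 * (\<gamma> + 1)" if z: "0 < z" "z < e" for z
  proof -
    have "\<gamma> * \<bar>Mn F n z\<bar> \<le> \<gamma> * z" "z * Ln F n z \<le> z * 1"
      using Mn_Ln_bounds[OF F n z(1)] z \<gamma> by (intro mult_left_mono; simp)+
    hence "\<gamma> * \<bar>Mn F n z\<bar> + z * Ln F n z \<le> z * (\<gamma> + 1)" by (simp add: algebra_simps)
    hence "T z \<le> max z 1 / z * (z * (\<gamma> + 1))"
      unfolding T_def using z by (intro mult_left_mono) auto
    also have "\<dots> = max z 1 * (\<gamma> + 1)" using z by simp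
    also have "\<dots> \<le> max e 1 * (\<gamma> + 1)" using z \<gamma> by (intro mult_right_mono) auto
    finally show ?thesis .
  qed
  obtain z where z: "0 < z" "z < e" "Ln F n z \<ge> 1 / 2" by (rule ex_Ln_ge_half[OF F n e])
  have "1 / 2 \<le> 1 / z * (z * Ln F n z)" using z by simp
  also have "\<dots> \<le> T z"
    unfolding T_def using z \<gamma> by (intro mult_mono divide_right_mono) auto
  also have "T z \<le> (SUP z\<in>{0<..<e}. T z)"
    using z T_le by (intro cSUP_upper bdd_aboveI2[where M = "max e 1 * (\<gamma> + 1)"]) auto
  finally show ?thesis by (simp only: L)
qed

lemma L_R_g1_ge:
  assumes F: "F \<in> distF" and n: "n > 0" and e: "e > 0" and \<gamma>: "\<gamma> > 0"
  shows "L_R F (g1 F) e \<gamma> n \<ge> 1 / 2"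
proof -
  have B: "Bn F n > 0" using sigma1sq_pos[OF F] n by (simp add: Bn_def)
  define T where "T z = max z 1 * Ln F n z" for z
  have L: "L_R F (g1 F) e \<gamma> n = \<gamma> * max e 1 / e * \<bar>Mn F n e\<bar> + (SUP z\<in>{0<..<e}. T z)"
    unfolding L_R_def T_def using B by (simp add: g1_ratio)
  have T_le: "T z \<le> max e 1 * 1" if z: "0 < z" "z < e" for z
    unfolding T_def using Mn_Ln_bounds[OF F n z(1)] z by (intro mult_mono) auto
  obtain z where z: "0 < z" "z < e" "Ln F n z \<ge> 1 / 2" by (rule ex_Ln_ge_half[OF F n e])
  have "1 / 2 \<le> 1 * Ln F n z" using z by simp
  also have "\<dots> \<le> T z"
    unfolding T_def using z by (intro mult_right_mono) auto
  also have "T z \<le> (SUP z\<in>{0<..<e}. T z)"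
    using z T_le by (intro cSUP_upper bdd_aboveI2[where M = "max e 1 * 1"]) auto
  finally have "1 / 2 \<le> (SUP z\<in>{0<..<e}. T z)" .
  moreover have "\<gamma> * max e 1 / e * \<bar>Mn F n e\<bar> \<ge> 0" using \<gamma> e by simp
  ultimately show ?thesis unfolding L by linarith
qed

lemma limsup_Delta_div:
  assumes F: "F \<in> distF" and L: "\<And>n. n > 0 \<Longrightarrow> L n \<ge> 1 / 2"
  shows "limsup (\<lambda>n. ereal (Delta F n / L n)) = 0"
proof -
  have "(\<lambda>n. Delta F n / L n) \<longlonglongrightarrow> 0"
  proof (rule Lim_null_comparison)
    show "(\<lambda>n. 2 * \<bar>Delta F n\<bar>) \<longlonglongrightarrow> 0"
      using tendsto_mult_left[OF tendsto_rabs[OF Delta_tendsto_0[OF F]], of 2] by simp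
    show "eventually (\<lambda>n. norm (Delta F n / L n) \<le> 2 * \<bar>Delta F n\<bar>) sequentially"
      using eventually_gt_at_top[of 0]
    proof eventually_elim
      case (elim n)
      have "\<bar>Delta F n\<bar> / L n \<le> \<bar>Delta F n\<bar> / (1 / 2)"
        using L[OF elim] by (intro divide_left_mono) auto
      thus ?case using L[OF elim] by (simp add: abs_divide)
    qed
  qed
  hence "(\<lambda>n. ereal (Delta F n / L n)) \<longlonglongrightarrow> ereal 0" by (rule tendsto_ereal)
  from lim_imp_Limsup[OF trivial_limit_sequentially this] show ?thesis by (simp only: zero_ereal_def)
qed

lemma C_AB_g1:
  assumes e: "e > 0" and \<gamma>: "\<gamma> > 0"
  shows "C_AB_E g1 e \<gamma> = 0" and "C_AB_R g1 e \<gamma> = 0"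
proof -
  \<comment> \<open>A supremum over the empty set would be -\<infinity> rather than 0.\<close>
  have "two_point (1 / 2) \<in> distF" by (rule two_point_in_distF) auto
  hence ne: "distF \<noteq> {}" by blast
  have "C_AB_E g1 e \<gamma> = (SUP F\<in>distF. 0)"
    unfolding C_AB_E_def by (intro SUP_cong refl limsup_Delta_div L_E_g1_ge e \<gamma>)
  thus "C_AB_E g1 e \<gamma> = 0" using ne by simp
  have "C_AB_R g1 e \<gamma> = (SUP F\<in>distF. 0)"
    unfolding C_AB_R_def by (intro SUP_cong refl limsup_Delta_div L_R_g1_ge e \<gamma>)
  thus "C_AB_R g1 e \<gamma> = 0" using ne by simp
qed

theorem theorem5:
  fixes \<epsilon> \<gamma> :: real
  assumes "\<epsilon> > 0" and "\<gamma> > 0"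
  shows
   "((INF e \<in> {0<..}. C_AB_E g0 e \<gamma>) \<ge>
      ereal (1 / (3 * sqrt (2 * pi))) *
      (SUP p \<in> {1/2<..<1}. ereal ((p + 1) /
          Max {1 - p, \<gamma> * (1 - p)\<^sup>2 + p\<^sup>2, \<gamma> * (2 * p - 1)})))
   \<and>
   ((INF e \<in> {0<..}. C_AB_E g0 e 1) \<ge> ereal ((sqrt 10 + 3) / (6 * sqrt (2 * pi))))
   \<and>
   (C_AB_R g0 \<epsilon> \<gamma> \<ge>
      (if \<gamma> / max \<epsilon> 1 < 2/3
       then ereal ((1 + sqrt 5) / (3 * sqrt (2 * pi) *
              (2 * \<gamma> * min (1 / \<epsilon>) 1 * (sqrt 5 - 2) + 3 - sqrt 5)))
       else ereal (1 / sqrt (2 * pi))))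
   \<and>
   (C_AB_E g1 \<epsilon> \<gamma> = 0 \<and> C_AB_R g1 \<epsilon> \<gamma> = 0)"
proof (intro conjI)
  define R where "R = sqrt (2 * pi)"
  have R: "R > 0" by (simp add: R_def)
  let ?M = "\<lambda>\<gamma> p :: real. Max {1 - p, \<gamma> * (1 - p)\<^sup>2 + p\<^sup>2, \<gamma> * (2 * p - 1)}"
  have "ereal (1 / (3 * R)) * (SUP p \<in> {1/2<..<1}. ereal ((p + 1) / ?M \<gamma> p))
     = (SUP p \<in> {1/2<..<1}. ereal (1 / (3 * R)) * ereal ((p + 1) / ?M \<gamma> p))"
  proof (rule SUP_ereal_mult_left[symmetric])
    fix p :: real assume "p \<in> {1/2<..<1}"
    hence "p + 1 \<ge> 0" "?M \<gamma> p \<ge> 0" by (auto simp: le_max_iff_disj)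
    thus "0 \<le> ereal ((p + 1) / ?M \<gamma> p)" by (simp only: ereal_less_eq zero_ereal_def divide_nonneg_nonneg)
  qed (use R in auto)
  also have "\<dots> \<le> C_AB_E g0 e \<gamma>" if "e > 0" for e
    using C_AB_E_g0_ge[OF _ _ \<open>\<gamma> > 0\<close> that] by (intro SUP_least) (simp add: R_def)
  hence "(SUP p \<in> {1/2<..<1}. ereal (1 / (3 * R)) * ereal ((p + 1) / ?M \<gamma> p)) \<le> (INF e \<in> {0<..}. C_AB_E g0 e \<gamma>)"
    by (intro INF_greatest) auto
  finally show "ereal (1 / (3 * sqrt (2 * pi))) * (SUP p \<in> {1/2<..<1}. ereal ((p + 1) / ?M \<gamma> p))
      \<le> (INF e \<in> {0<..}. C_AB_E g0 e \<gamma>)"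
    unfolding R_def .
  show "ereal ((sqrt 10 + 3) / (6 * sqrt (2 * pi))) \<le> (INF e \<in> {0<..}. C_AB_E g0 e 1)"
  proof (intro INF_greatest)
    fix e :: real assume e: "e \<in> {0<..}"
    \<comment> \<open>The critical point of \<open>(p + 1) / ((1 - p)^2 + p^2)\<close>, that is, the
      positive root of \<open>2 * p^2 + 4 * p = 3\<close>. By this equation the second entry of the
      maximum becomes \<open>4 - 6 * p\<close>; the bound 5/8 below is where that line meets the
      third entry \<open>2 * p - 1\<close>.\<close>
    define p :: real where "p = (sqrt 10 - 2) / 2"
    have s10: "3 < sqrt 10" "sqrt 10 < 13 / 4"
      by (rule real_less_rsqrt, simp) (rule real_less_lsqrt, simp_all add: power2_eq_square)
    hence p: "1 / 2 < p" "p < 1" "p < 5 / 8" by (auto simp: p_def)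
    have pp: "2 * p\<^sup>2 = 3 - 4 * p" by (simp add: p_def power2_eq_square field_simps)
    have "?M 1 p = 4 - 6 * p"
      using p pp by (simp add: power2_eq_square algebra_simps max_def)
    moreover have "4 - 6 * p = 10 - 3 * sqrt 10" by (simp add: p_def diff_divide_distrib)
    moreover have "p + 1 = sqrt 10 / 2" by (simp add: p_def diff_divide_distrib)
    moreover have "sqrt 10 / 2 / (3 * R) / (10 - 3 * sqrt 10) = (sqrt 10 + 3) / (6 * R)"
    proof -
      have "10 - 3 * sqrt 10 = sqrt 10 * (sqrt 10 - 3)" by (simp add: algebra_simps)
      moreover have "(sqrt 10 + 3) * (sqrt 10 - 3) = 1" by (simp add: algebra_simps)
      hence "1 / (sqrt 10 - 3) = sqrt 10 + 3" using s10 by (simp add: divide_eq_eq)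
      ultimately show ?thesis using R s10 by (simp add: field_simps)
    qed
    ultimately show "ereal ((sqrt 10 + 3) / (6 * sqrt (2 * pi))) \<le> C_AB_E g0 e 1"
      using C_AB_E_g0_ge[OF p(1,2), of 1 e] e by (simp only: R_def) simp
  qed
  show "(if \<gamma> / max \<epsilon> 1 < 2/3
       then ereal ((1 + sqrt 5) / (3 * sqrt (2 * pi) *
              (2 * \<gamma> * min (1 / \<epsilon>) 1 * (sqrt 5 - 2) + 3 - sqrt 5)))
       else ereal (1 / sqrt (2 * pi))) \<le> C_AB_R g0 \<epsilon> \<gamma>"
  proof (cases "\<gamma> / max \<epsilon> 1 < 2 / 3")
    case True
    \<comment> \<open>The point where \<open>max (1 - p) (p^2)\<close> changes branch. With
      \<open>t = \<gamma> / max \<epsilon> 1\<close>, the derivative of the quotient has the sign of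
      \<open>2 - 3 * t\<close> to its left and is negative to its right, so for
      \<open>t < 2/3\<close> the maximum is here.\<close>
    define p :: real where "p = (sqrt 5 - 1) / 2"
    have s5: "2 < sqrt 5" "sqrt 5 < 3" by (auto intro: real_less_rsqrt real_less_lsqrt)
    hence p: "1 / 2 < p" "p < 1" by (auto simp: p_def)
    have pp: "p\<^sup>2 = 1 - p" by (simp add: p_def power2_eq_square field_simps)
    define t where "t = \<gamma> * min (1 / \<epsilon>) 1"
    have t: "\<gamma> / max \<epsilon> 1 = t" using \<open>\<epsilon> > 0\<close> by (auto simp: t_def min_def max_def divide_simps)
    have t0: "t > 0" using assms by (simp add: t_def)
    have "(p + 1) / (3 * R) / (t * (2 * p - 1) + (1 - p)) = (1 + sqrt 5) / (3 * R * (2 * t * (sqrt 5 - 2) + 3 - sqrt 5))"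
    proof -
      have D: "2 * (t * (2 * p - 1) + (1 - p)) = 2 * t * (sqrt 5 - 2) + 3 - sqrt 5"
        by (simp add: p_def field_simps)
      have N: "1 + sqrt 5 = 2 * (p + 1)" by (simp add: p_def diff_divide_distrib)
      have "a / b / c = 2 * a / (b * (2 * c))" for a b c :: real by simp
      thus ?thesis unfolding D[symmetric] N .
    qed
    with C_AB_R_g0_ge[OF p \<open>\<gamma> > 0\<close> \<open>\<epsilon> > 0\<close>] show ?thesis
      using True by (simp add: pp t R_def t_def mult.assoc)
  next
    case False
    \<comment> \<open>For \<open>t \<ge> 2/3\<close> the quotient no longer increases in
      \<open>p\<close>, so the best choice is the symmetric case \<open>p = 1/2\<close>. The third
      moment vanishes there, and \<gamma> and \<epsilon> disappear from the bound.\<close>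
    have "max (1 / 2) ((1 / 2)\<^sup>2) = (1 / 2 :: real)" by (simp add: power2_eq_square)
    thus ?thesis
      using C_AB_R_g0_ge_rational[of "1 / 2", OF _ _ _ \<open>\<gamma> > 0\<close> \<open>\<epsilon> > 0\<close>] False by simp
  qed
qed (use C_AB_g1 assms in auto)

end
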